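(* Let $L=(S(t),\ast)$ be a Lie superalgebra of the type $S(t)$, where $\ast$ is the orthogonal or symplectic involution. Then the graded PI-exponent $\exp^{gr}(L)=\lim_{n\to\infty}\sqrt[n]{c_n^{gr}(L)}$ of $L$ exists and $\exp^{gr}(L)=2t$ if $t$ is even, and $\exp^{gr}(L)=2t-1$ if $t$ is odd.
   Context: $F$ is a field of characteristic zero. For a $\mathbb Z_2$-graded algebra $L=L_0\oplus L_1$, let $P_{k,n-k}$ be the space of multilinear nonassociative polynomials in even variables $x_1,\dots,x_k$ and odd variables $y_1,\dots,y_{n-k}$ of the absolutely free $\mathbb Z_2$-graded algebra, $Id^{gr}(L)$ the ideal of graded identities of $L$, $c_{k,n-k}(L)=\dim P_{k,n-k}/(P_{k,n-k}\cap Id^{gr}(L))$, and $c_n^{gr}(L)=\sum_{k=0}^n\binom nk c_{k,n-k}(L)$ the graded codimensions. Superalgebra $S(t)$, $t\ge 2$: take $R=UT_t(F)$ (upper triangular $t\times t$ matrices) with an involution $\ast$, either the orthogonal one $e_{ij}^\circ=e_{t+1-j,t+1-i}$, or (for $t=2m$ even) the symplectic one $X^s=DX^\circ D^{-1}$ with $D=\mathrm{diag}(E,-E)$, $E$ the $m\times m$ identity. Let $R^+=\{x: x^\ast=x\}$, $R^-=\{x:x^\ast=-x\}$. Then $S(t)=\{\begin{pmatrix} x& y\\ z& -x^\ast\end{pmatrix}: x\in R, y\in R^+, z\in R^-\}$, with even part the block-diagonal matrices and odd part the block-off-diagonal matrices, and product the supercommutator $[a,b]=ab-(-1)^{|a||b|}ba$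 of $M_2(R)$. It is a finite-dimensional solvable Lie superalgebra with non-nilpotent commutator subalgebra. *)

theory Defs
  imports Complex_Main "HOL-Library.Function_Algebras"
begin

type_synonym 'a mat_fn = "nat \<Rightarrow> nat \<Rightarrow> 'a"

definition mmul :: "nat \<Rightarrow> 'a::field mat_fn \<Rightarrow> 'a mat_fn \<Rightarrow> 'a mat_fn" where
  "mmul N A B = (\<lambda>i j. \<Sum>l<N. A i l * B l j)"

definition UT :: "nat \<Rightarrow> 'a::field mat_fn set" where
  "UT t = {X. \<forall>i j. \<not> (i \<le> j \<and> j < t) \<longrightarrow> X i j = 0}"

datatype inv_kind = Orth | Symp

text \<open>Orthogonal involution: e_ij \<mapsto> e_{t+1-j,t+1-i} (1-based), i.e. X(i,j) := X(t-1-j,t-1-i) (0-based).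
  Symplectic (t = 2m): X^s = D X^o D^{-1}, D = diag(E,-E), i.e. X^s(i,j) = d_i d_j X^o(i,j).\<close>
definition sgnD :: "nat \<Rightarrow> nat \<Rightarrow> 'a::field" where
  "sgnD t i = (if i < t div 2 then 1 else -1)"

definition invol :: "inv_kind \<Rightarrow> nat \<Rightarrow> 'a::field mat_fn \<Rightarrow> 'a mat_fn" where
  "invol k t X = (\<lambda>i j. if i < t \<and> j < t then
       (case k of Orth \<Rightarrow> X (t - 1 - j) (t - 1 - i)
                | Symp \<Rightarrow> sgnD t i * sgnD t j * X (t - 1 - j) (t - 1 - i))
     else 0)"

definition Rplus :: "inv_kind \<Rightarrow> nat \<Rightarrow> 'a::field mat_fn set" where
  "Rplus k t = {X \<in> UT t. invol k t X = X}"

definition Rminus :: "inv_kind \<Rightarrow> nat \<Rightarrow> 'a::field mat_fn set" where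
  "Rminus k t = {X \<in> UT t. invol k t X = (\<lambda>i j. - X i j)}"

definition blk :: "nat \<Rightarrow> 'a::field mat_fn \<Rightarrow> 'a mat_fn \<Rightarrow> 'a mat_fn \<Rightarrow> 'a mat_fn \<Rightarrow> 'a mat_fn" where
  "blk t x y z w = (\<lambda>i j.
      if i < t \<and> j < t then x i j
      else if i < t \<and> t \<le> j \<and> j < 2*t then y i (j - t)
      else if t \<le> i \<and> i < 2*t \<and> j < t then z (i - t) j
      else if t \<le> i \<and> i < 2*t \<and> t \<le> j \<and> j < 2*t then w (i - t) (j - t)
      else 0)"

definition S_even :: "inv_kind \<Rightarrow> nat \<Rightarrow> 'a::field mat_fn set" where
  "S_even k t = {blk t x (\<lambda>_ _. 0) (\<lambda>_ _. 0) (\<lambda>i j. - invol k t x i j) | x. x \<in> UT t}"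

definition S_odd :: "inv_kind \<Rightarrow> nat \<Rightarrow> 'a::field mat_fn set" where
  "S_odd k t = {blk t (\<lambda>_ _. 0) y z (\<lambda>_ _. 0) | y z. y \<in> Rplus k t \<and> z \<in> Rminus k t}"

datatype nmon = Var nat | Mul nmon nmon

fun leaves :: "nmon \<Rightarrow> nat list" where
  "leaves (Var i) = [i]"
| "leaves (Mul a b) = leaves a @ leaves b"

text \<open>Multilinear monomials of degree n in the variables 0..n-1 (each exactly once);
  they span P_n of the absolutely free nonassociative algebra.\<close>
definition multilin :: "nat \<Rightarrow> nmon set" where
  "multilin n = {m. distinct (leaves m) \<and> set (leaves m) = {..<n}}"

text \<open>Evaluation in S(t) (size N = 2t matrices) with the supercommutator product,
  variable i being even iff i < k. Returns the value and its parity (True = odd).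
  For homogeneous a, b: [a,b] = ab - (-1)^{|a||b|} ba.\<close>
fun seval :: "nat \<Rightarrow> nat \<Rightarrow> (nat \<Rightarrow> 'a::field mat_fn) \<Rightarrow> nmon \<Rightarrow> 'a mat_fn \<times> bool" where
  "seval N k \<sigma> (Var i) = (\<sigma> i, \<not> i < k)"
| "seval N k \<sigma> (Mul a b) =
     (let (x, p) = seval N k \<sigma> a; (y, q) = seval N k \<sigma> b in
      ((\<lambda>i j. mmul N x y i j - (if p \<and> q then -1 else 1) * mmul N y x i j), p \<noteq> q))"

definition gr_subst :: "inv_kind \<Rightarrow> nat \<Rightarrow> nat \<Rightarrow> nat \<Rightarrow> (nat \<Rightarrow> 'a::field mat_fn) \<Rightarrow> bool" where
  "gr_subst kd t k n \<sigma> = ((\<forall>i<k. \<sigma> i \<in> S_even kd t) \<and> (\<forall>i. k \<le> i \<and> i < n \<longrightarrow> \<sigma> i \<in> S_odd kd t))"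

definition mon_fun :: "inv_kind \<Rightarrow> nat \<Rightarrow> nat \<Rightarrow> nat \<Rightarrow> nmon \<Rightarrow> (nat \<Rightarrow> 'a::field mat_fn) \<Rightarrow> 'a mat_fn" where
  "mon_fun kd t k n m = (\<lambda>\<sigma>. if gr_subst kd t k n \<sigma> then fst (seval (2*t) k \<sigma> m) else (\<lambda>_ _. 0))"

definition fscale :: "'a::field \<Rightarrow> ((nat \<Rightarrow> 'a mat_fn) \<Rightarrow> 'a mat_fn) \<Rightarrow> ((nat \<Rightarrow> 'a mat_fn) \<Rightarrow> 'a mat_fn)" where
  "fscale c f = (\<lambda>\<sigma> i j. c * f \<sigma> i j)"

lemma vector_space_fscale: "vector_space (fscale :: 'a::field \<Rightarrow> _)"
  by unfold_locales (auto simp: fscale_def fun_eq_iff algebra_simps)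

text \<open>c_{k,n-k}(L) = dim P_{k,n-k}/(P_{k,n-k} \<inter> Id^gr(L)): since a polynomial is a graded identity
  iff its induced function on graded substitutions vanishes, this quotient is isomorphic to the
  span of the induced functions of the multilinear monomials.\<close>
definition ccodim :: "inv_kind \<Rightarrow> nat \<Rightarrow> nat \<Rightarrow> nat \<Rightarrow> nat" where
  "ccodim kd t k n = vector_space.dim (fscale :: 'a::field_char_0 \<Rightarrow> _)
       (mon_fun kd t k n ` multilin n)"

definition gr_codim :: "'a::field_char_0 itself \<Rightarrow> inv_kind \<Rightarrow> nat \<Rightarrow> nat \<Rightarrow> nat" where
  "gr_codim _ kd t n = (\<Sum>k\<le>n. (n choose k) * ccodim TYPE('a) kd t k n)"

end

theory Submission
  imports Defs "HOL-Library.FuncSet" "HOL-Combinatorics.Multiset_Permutations"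
begin

text \<open>Put \<open>N = t + 2 (t div 2)\<close>, which is \<open>2t\<close> or \<open>2t - 1\<close>.

  Upper bound: with respect to a suitable ranking of the \<open>2t\<close> indices every element of \<open>S(t)\<close> is
  triangular. The entries of a monomial are sums over paths of nondecreasing rank, so at most
  \<open>2t\<close> variables contribute a rank-raising entry, and the others contribute one of \<open>t\<close> (even
  variables) or \<open>2 (t div 2)\<close> (odd variables) linear forms. For odd \<open>t\<close> the middle diagonal
  entry of \<open>y\<close> can be counted as rank-raising because the one of \<open>z\<close> vanishes.

  Lower bound: modulo the strictly triangular part, \<open>S(t)\<close> is a sum of \<open>t div 2\<close> copies of
  \<open>gl(1|1)\<close>, one for each pair of indices \<open>i\<close>, \<open>bar i = t - 1 - i\<close>, and for odd \<open>t\<close> of a middle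
  part. The matrix unit at \<open>(i, bar i)\<close> gives an even and an odd weight vector of different
  weights for the \<open>i\<close>-th copy, both killed by all other copies. A left-normed monomial that
  moves through these vectors, absorbing \<open>q\<close> variables at each of \<open>N\<close> kinds of places, detects
  which variables were substituted by which basis elements. Hence the \<open>(N q)! / q!\<^sup>N\<close> balanced
  distributions of the variables give independent monomials.\<close>

section \<open>The upper bound\<close>

interpretation fs: vector_space "fscale :: 'a::field \<Rightarrow> _"
  by (rule vector_space_fscale)

section \<open>Linear combinations of scalar-valued functions\<close>

text \<open>Entries of monomials are scalar functions of the substitution and get multiplied with
  each other, so they need a span of their own besides the space of matrix-valued functions that
  carries \<open>fscale\<close>.\<close>

inductive_set lin_comb :: "('b \<Rightarrow> 'a::field) set \<Rightarrow> ('b \<Rightarrow> 'a) set" for G where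
  lin_zero: "(\<lambda>_. 0) \<in> lin_comb G"
| lin_step: "g \<in> G \<Longrightarrow> f \<in> lin_comb G \<Longrightarrow> (\<lambda>x. c * g x + f x) \<in> lin_comb G"

lemma lin_add:
  assumes "f \<in> lin_comb G" "h \<in> lin_comb G" shows "(\<lambda>x. f x + h x) \<in> lin_comb G"
  using assms(1)
proof induction
  case lin_zero then show ?case using assms(2) by simp
next
  case (lin_step g f c)
  from lin_comb.lin_step[OF lin_step(1) lin_step(3), of c] show ?case by (simp add: add.assoc)
qed

lemma lin_scale: "f \<in> lin_comb G \<Longrightarrow> (\<lambda>x. c * f x) \<in> lin_comb G"
proof (induction rule: lin_comb.induct)
  case lin_zero then show ?case by (simp add: lin_comb.lin_zero)
next
  case (lin_step g f d)
  from lin_comb.lin_step[OF lin_step(1) lin_step(3), of "c * d"] show ?case by (simp add: algebra_simps)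
qed

lemma lin_base: "g \<in> G \<Longrightarrow> g \<in> lin_comb G"
  using lin_step[OF _ lin_zero, of g G 1] by simp

lemma lin_mono: "f \<in> lin_comb G \<Longrightarrow> G \<subseteq> H \<Longrightarrow> f \<in> lin_comb H"
  by (induction rule: lin_comb.induct) (auto intro: lin_comb.intros)

lemma lin_sum:
  "finite A \<Longrightarrow> (\<And>a. a \<in> A \<Longrightarrow> f a \<in> lin_comb G) \<Longrightarrow> (\<lambda>x. \<Sum>a\<in>A. f a x) \<in> lin_comb G"
  by (induction A rule: finite_induct) (auto intro: lin_zero lin_add)

text \<open>Bilinearity: two nested inductions reduce the claim to products of single
  generators.\<close>

lemma lin_mult:
  assumes f: "f \<in> lin_comb G" and h: "h \<in> lin_comb H"
    and K: "\<And>g k. g \<in> G \<Longrightarrow> k \<in> H \<Longrightarrow> (\<lambda>x. g x * k x) \<in> K"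
  shows "(\<lambda>x. f x * h x) \<in> lin_comb K"
proof -
  have one: "(\<lambda>x. g x * h x) \<in> lin_comb K" if "g \<in> G" for g
    using h
  proof induction
    case lin_zero then show ?case by (simp add: lin_comb.lin_zero)
  next
    case (lin_step k h c)
    from lin_comb.lin_step[OF K[OF that lin_step(1)] lin_step(3), of c] show ?case
      by (simp add: algebra_simps)
  qed
  show ?thesis using f
  proof induction
    case lin_zero then show ?case by (simp add: lin_comb.lin_zero)
  next
    case (lin_step g f c)
    from lin_add[OF lin_scale[OF one[OF lin_step(1)], of c] lin_step(3)] show ?case
      by (simp add: algebra_simps)
  qed
qed

lemma lin_empty: "f \<in> lin_comb {} \<Longrightarrow> f = (\<lambda>_. 0)"
  by (induction rule: lin_comb.induct) auto

text \<open>For odd \<open>t\<close> the tie between the two copies of the middle index is broken, so that the middle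
  diagonal entry of the \<open>y\<close>-block raises the rank; that of the \<open>z\<close>-block is zero on \<open>R\<^sup>-\<close>.\<close>
definition rank :: "nat \<Rightarrow> nat \<Rightarrow> nat" where
  "rank t p = 2 * (p mod t) + (if odd t \<and> p = t + t div 2 then 1 else 0)"

definition strict_pos :: "nat \<Rightarrow> (nat \<times> nat) set" where
  "strict_pos t = {(p, q). p < 2 * t \<and> q < 2 * t \<and> rank t p < rank t q}"

text \<open>Representatives of the entries that keep the rank and need not vanish, one for each
  linear form up to scalars. The lower even block repeats the diagonal of the upper one, and the
  diagonals of \<open>y\<close> and \<open>z\<close> are determined by their first
  \<open>t div 2\<close> entries, the middle ones for odd \<open>t\<close> being strict or
  zero.\<close>

definition flat_pos :: "nat \<Rightarrow> bool \<Rightarrow> (nat \<times> nat) set" where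
  "flat_pos t b = (if b then (\<lambda>i. (i, t + i)) ` {..<t div 2} \<union> (\<lambda>i. (t + i, i)) ` {..<t div 2}
                   else (\<lambda>i. (i, i)) ` {..<t})"

definition S_part :: "inv_kind \<Rightarrow> nat \<Rightarrow> bool \<Rightarrow> 'a::field mat_fn set" where
  "S_part kd t b = (if b then S_odd kd t else S_even kd t)"

lemma rank_low: "p < t \<Longrightarrow> rank t p = 2 * p"
  by (auto simp: rank_def)

lemma rank_high: "p < t \<Longrightarrow> rank t (t + p) = 2 * p + (if odd t \<and> p = t div 2 then 1 else 0)"
  by (auto simp: rank_def)

lemma rank_bound: "p < 2 * t \<Longrightarrow> rank t p \<le> 2 * t"
  by (cases "p < t") (use rank_low rank_high[of "p - t" t] in auto)

lemma sgnD_square: "sgnD t i * sgnD t i = 1"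
  by (simp add: sgnD_def)

lemma finite_flat_pos [simp]: "finite (flat_pos t b)"
  by (simp add: flat_pos_def)

lemma finite_strict_pos [simp]: "finite (strict_pos t)"
  by (rule finite_subset[of _ "{..<2*t} \<times> {..<2*t}"]) (auto simp: strict_pos_def)

lemma card_flat_pos: "card (flat_pos t b) = (if b then 2 * (t div 2) else t)"
proof (cases b)
  case True
  have "((\<lambda>i. (i, t + i)) ` {..<t div 2}) \<inter> ((\<lambda>i. (t + i, i)) ` {..<t div 2}) = {}"
    by auto
  then have "card (flat_pos t b) = card ((\<lambda>i. (i, t + i)) ` {..<t div 2}) + card ((\<lambda>i. (t + i, i))
      ` {..<t div 2})"
    using True by (simp add: flat_pos_def card_Un_disjoint)
  also have "\<dots> = 2 * (t div 2)"
    by (simp add: card_image inj_on_def)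
  finally show ?thesis using True by simp
qed (simp add: flat_pos_def card_image inj_on_def)

lemma flat_pos_rank: "(p, q) \<in> flat_pos t b \<Longrightarrow> rank t p = rank t q"
  by (auto simp: flat_pos_def rank_low rank_high split: if_splits)

lemma flat_strict_disjoint: "flat_pos t b \<inter> strict_pos t = {}"
  using flat_pos_rank by (fastforce simp: strict_pos_def)

section \<open>Sorting the matrix entries by rank\<close>

lemma index_split:
  fixes p t :: nat
  obtains (low) "p < t" | (high) p' where "p = t + p'" "p' < t" | (out) "\<not> p < 2 * t"
  by (metis add_diff_inverse_nat mult_2 nat_add_left_cancel_less)

lemma blk_entry:
  assumes "i < t" "j < t"
  shows "blk t x y z w i j = x i j" "blk t x y z w i (t + j) = y i j"
    "blk t x y z w (t + i) j = z i j" "blk t x y z w (t + i) (t + j) = w i j"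
  using assms by (auto simp: blk_def)

text \<open>Both diagonal blocks are upper triangular. The diagonal of the lower one is the
  reflected negative of the upper diagonal; the signs of the symplectic involution cancel
  there.\<close>

lemma even_entry_cases:
  "(\<forall>s \<in> S_even kd t. (s :: 'a::field_char_0 mat_fn) p q = 0) \<or> (p, q) \<in> strict_pos t \<or>
   (p < 2 * t \<and> q < 2 * t \<and> rank t p = rank t q \<and>
     (\<exists>c. \<exists>\<beta> \<in> flat_pos t False. \<forall>s \<in> S_even kd t. s p q = c * (s :: 'a mat_fn) (fst \<beta>) (snd \<beta>)))"
proof (cases p t rule: index_split)
  case low
  then show ?thesis
  proof (cases q t rule: index_split)
    case low2: low
    show ?thesis
    proof (cases "p < q")
      case True
      then show ?thesis using low low2 by (auto simp: strict_pos_def rank_low)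
    next
      case False
      show ?thesis
      proof (cases "p = q")
        case True
        then show ?thesis using low low2
          by (intro disjI2) (auto simp: flat_pos_def intro!: exI[of _ 1])
      next
        case False
        then show ?thesis using \<open>\<not> p < q\<close> low low2 by (auto simp: S_even_def blk_def UT_def)
      qed
    qed
  qed (auto simp: S_even_def blk_def)
next
  case (high p')
  then show ?thesis
  proof (cases q t rule: index_split)
    case (high q')
    note q = this and p = \<open>p = t + p'\<close> \<open>p' < t\<close>
    consider "p' < q'" | "p' = q'" | "q' < p'" by linarith
    then show ?thesis
    proof cases
      case 1
      then show ?thesis using p q by (auto simp: strict_pos_def rank_high)
    next
      case 2
      have "\<forall>s \<in> S_even kd t. s p q = (-1) * (s :: 'a mat_fn) (t - 1 - p') (t - 1 - p')"
        using p q 2 by (auto simp: S_even_def blk_def invol_def sgnD_square split: inv_kind.splits)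
      moreover have "(t - 1 - p', t - 1 - p') \<in> flat_pos t False"
        using p by (auto simp: flat_pos_def)
      ultimately show ?thesis using p q 2
        by (intro disjI2) (auto intro!: exI[of _ "-1"] bexI[of _ "(t - 1 - p', t - 1 - p')"])
    next
      case 3
      then show ?thesis using p q
        by (auto simp: S_even_def blk_def invol_def UT_def split: inv_kind.splits)
    qed
  qed (auto simp: S_even_def blk_def)
qed (auto simp: S_even_def blk_def)

lemma Rplus_diag:
  assumes "y \<in> Rplus kd t" "i < t" shows "y (t - 1 - i) (t - 1 - i) = y i i"
proof -
  from assms(1) have "invol kd t y i i = y i i"
    by (simp add: Rplus_def)
  then show ?thesis using assms(2)
    by (auto simp: invol_def sgnD_square split: inv_kind.splits)
qed

lemma Rminus_diag:
  assumes "z \<in> Rminus kd t" "i < t" shows "z (t - 1 - i) (t - 1 - i) = - z i i"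
proof -
  from assms(1) have "invol kd t z i i = - z i i"
    by (auto simp: Rminus_def fun_eq_iff)
  then show ?thesis using assms(2)
    by (auto simp: invol_def sgnD_square split: inv_kind.splits)
qed

text \<open>Above the diagonals the rank rises, below them the blocks vanish, and on the diagonals
  the reflection symmetry of \<open>R+\<close> and \<open>R-\<close> halves the number of
  coordinates.\<close>

lemma odd_entry_cases:
  "(\<forall>s \<in> S_odd kd t. (s :: 'a::field_char_0 mat_fn) p q = 0) \<or> (p, q) \<in> strict_pos t \<or>
   (p < 2 * t \<and> q < 2 * t \<and> rank t p = rank t q \<and>
     (\<exists>c. \<exists>\<beta> \<in> flat_pos t True. \<forall>s \<in> S_odd kd t. s p q = c * (s :: 'a mat_fn) (fst \<beta>) (snd \<beta>)))"
proof (cases p t rule: index_split)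
  case low
  then show ?thesis
  proof (cases q t rule: index_split)
    case (high q')
    consider "p < q'" | "p = q'" | "q' < p" by linarith
    then show ?thesis
    proof cases
      case 1
      then show ?thesis using low high by (auto simp: strict_pos_def rank_high rank_low)
    next
      case 2
      \<comment> \<open>The middle index, the half that holds the representatives, and the half that
        is reflected onto it.\<close>
      consider "odd t" "p = t div 2" | "p < t div 2" | "t - 1 - p < t div 2"
        using low by (cases "even t") (auto elim!: evenE oddE, linarith+)
      then show ?thesis
      proof cases
        case 1
        then show ?thesis using low high 2 by (auto simp: strict_pos_def rank_high rank_low)
      next
        case 3: 2
        then show ?thesis using low high 2
          by (intro disjI2) (auto simp: flat_pos_def rank_low rank_high intro!: exI[of _ 1]
            bexI[of _ "(p, t + p)"])
      next
        case 4: 3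
        have "t - 1 - p < t" using low by simp
        then have "\<forall>s \<in> S_odd kd t. s p q = 1 * (s :: 'a mat_fn) (t - 1 - p) (t + (t - 1 - p))"
          unfolding S_odd_def high(1) 2[symmetric]
          by (safe, simp only: blk_entry low mult_1_left) (rule Rplus_diag[OF _ low, symmetric])
        moreover have "(t - 1 - p, t + (t - 1 - p)) \<in> flat_pos t True"
          using 4 by (auto simp: flat_pos_def)
        moreover have "rank t p = rank t q"
          using 2 4 low high by (auto simp: rank_low rank_high elim!: oddE)
        ultimately show ?thesis using low high 2
          by (intro disjI2 conjI) (auto intro!: exI[of _ 1] bexI[of _ "(t - 1 - p, t + (t - 1 - p))"])
      qed
    next
      case 3
      then show ?thesis using low high
        by (auto simp: S_odd_def blk_def Rplus_def UT_def)
    qed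
  qed (auto simp: S_odd_def blk_def)
next
  case (high p')
  then show ?thesis
  proof (cases q t rule: index_split)
    case low
    note p = \<open>p = t + p'\<close> \<open>p' < t\<close>
    consider "p' < q" | "p' = q" | "q < p'" by linarith
    then show ?thesis
    proof cases
      case 1
      then show ?thesis using low p by (auto simp: strict_pos_def rank_high rank_low)
    next
      case 2
      consider "odd t" "q = t div 2" | "q < t div 2" | "t - 1 - q < t div 2"
        using low by (cases "even t") (auto elim!: evenE oddE, linarith+)
      then show ?thesis
      proof cases
        case 1
        \<comment> \<open>The middle index is its own reflection, so this entry is its own negative
          and vanishes in characteristic zero.\<close>
        have "z q q = 0" if "z \<in> Rminus kd t" for z :: "'a mat_fn"
          using Rminus_diag[OF that low] 1 by (auto elim!: oddE simp: eq_neg_iff_add_eq_0)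
        then show ?thesis using low p 2 by (auto simp: S_odd_def blk_def)
      next
        case 3: 2
        then show ?thesis using low p 2
          by (intro disjI2) (auto simp: flat_pos_def rank_low rank_high intro!: exI[of _ 1]
            bexI[of _ "(t + q, q)"])
      next
        case 4: 3
        have "t - 1 - q < t" using low by simp
        then have "\<forall>s \<in> S_odd kd t. s p q = (-1) * (s :: 'a mat_fn) (t + (t - 1 - q)) (t - 1 - q)"
          unfolding S_odd_def p(1) 2
          by (safe, simp only: blk_entry low mult_minus1) (metis Rminus_diag[OF _ low] minus_minus)
        moreover have "(t + (t - 1 - q), t - 1 - q) \<in> flat_pos t True"
          using 4 by (auto simp: flat_pos_def)
        moreover have "rank t p = rank t q"
          using 2 4 low p by (auto simp: rank_low rank_high elim!: oddE)
        ultimately show ?thesis using low p 2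
          by (intro disjI2 conjI) (auto intro!: exI[of _ "-1"] bexI[of _ "(t + (t - 1 - q), t - 1
            - q)"])
      qed
    next
      case 3
      then show ?thesis using low p
        by (auto simp: S_odd_def blk_def Rminus_def UT_def)
    qed
  qed (auto simp: S_odd_def blk_def)
qed (auto simp: S_odd_def blk_def)

lemma S_entry_cases:
  obtains (zero) "\<And>s. s \<in> S_part kd t b \<Longrightarrow> (s :: 'a::field_char_0 mat_fn) p q = 0"
  | (strict) "(p, q) \<in> strict_pos t"
  | (flat) c \<beta> where "p < 2 * t" "q < 2 * t" "rank t p = rank t q" "\<beta> \<in> flat_pos t b"
      "\<And>s. s \<in> S_part kd t b \<Longrightarrow> s p q = c * (s :: 'a mat_fn) (fst \<beta>) (snd \<beta>)"
proof (cases b)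
  case True
  then show ?thesis using odd_entry_cases[where ?'a = 'a, of kd t p q] that
    unfolding S_part_def by simp blast
next
  case False
  then show ?thesis using even_entry_cases[where ?'a = 'a, of kd t p q] that
    unfolding S_part_def by simp blast
qed

section \<open>Expansion of monomials along paths\<close>

text \<open>A product of matrix coordinates, one for each variable in \<open>V\<close>. The value 0
  outside the graded substitutions matches \<open>mon_fun\<close>.\<close>

definition coord_prod ::
  "inv_kind \<Rightarrow> nat \<Rightarrow> nat \<Rightarrow> nat \<Rightarrow> nat set \<Rightarrow> (nat \<Rightarrow> nat \<times> nat) \<Rightarrow> (nat \<Rightarrow> 'a::field mat_fn) \<Rightarrow> 'a" where
  "coord_prod kd t k n V \<beta> = (\<lambda>\<sigma>. if gr_subst kd t k n \<sigma> then \<Prod>l\<in>V. \<sigma> l (fst (\<beta> l)) (snd (\<beta> l)) else 0)"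

text \<open>Passing to representatives of flat entries destroys the chain of matrix indices. What is
  kept of a path from \<open>p\<close> to \<open>q\<close> is the rank inequality: every strict
  entry raises the rank by at least one.\<close>

definition paths :: "nat \<Rightarrow> nat \<Rightarrow> nat set \<Rightarrow> nat \<Rightarrow> nat \<Rightarrow> (nat \<Rightarrow> nat \<times> nat) set" where
  "paths t k V p q = {\<beta>. p < 2 * t \<and> q < 2 * t \<and>
     (\<forall>l\<in>V. \<beta> l \<in> strict_pos t \<union> flat_pos t (\<not> l < k)) \<and>
     rank t p + card {l\<in>V. \<beta> l \<in> strict_pos t} \<le> rank t q}"

fun spar :: "nat \<Rightarrow> nmon \<Rightarrow> bool" where
  "spar k (Var i) = (\<not> i < k)"
| "spar k (Mul a b) = (spar k a \<noteq> spar k b)"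

lemma snd_seval: "snd (seval N k \<sigma> m) = spar k m"
  by (induction m) (auto simp: Let_def split: prod.splits)

lemma fst_seval_Mul:
  "fst (seval N k \<sigma> (Mul a b)) p q =
     (\<Sum>l<N. fst (seval N k \<sigma> a) p l * fst (seval N k \<sigma> b) l q)
     + (if spar k a \<and> spar k b then 1 else -1) *
        (\<Sum>l<N. fst (seval N k \<sigma> b) p l * fst (seval N k \<sigma> a) l q)"
  using snd_seval[of N k \<sigma> a] snd_seval[of N k \<sigma> b]
  by (auto simp: Let_def mmul_def split: prod.splits)

text \<open>Merging the two assignments joins the paths at \<open>l\<close>. The rank inequalities
  add up because the strict positions belong to disjoint sets of variables.\<close>

lemma coord_prod_mult:
  assumes "\<beta> \<in> paths t k V p l" "\<gamma> \<in> paths t k W l q" "V \<inter> W = {}" "finite V" "finite W"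
  shows "(\<lambda>\<sigma>. coord_prod kd t k n V \<beta> \<sigma> * coord_prod kd t k n W \<gamma> \<sigma>)
           \<in> coord_prod kd t k n (V \<union> W) ` paths t k (V \<union> W) p q"
proof -
  define \<delta> where "\<delta> = (\<lambda>l. if l \<in> V then \<beta> l else \<gamma> l)"
  have W: "l \<in> W \<Longrightarrow> l \<notin> V" for l using assms(3) by auto
  have "{l \<in> V \<union> W. \<delta> l \<in> strict_pos t} = {l \<in> V. \<beta> l \<in> strict_pos t} \<union> {l \<in> W. \<gamma> l \<in> strict_pos t}"
    using W by (auto simp: \<delta>_def)
  moreover have "card \<dots> = card {l \<in> V. \<beta> l \<in> strict_pos t} + card {l \<in> W. \<gamma> l \<in> strict_pos t}"
    using assms by (intro card_Un_disjoint) auto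
  ultimately have "\<delta> \<in> paths t k (V \<union> W) p q"
    using assms(1,2) W by (auto simp: paths_def \<delta>_def)
  moreover have "(\<Prod>l\<in>V \<union> W. \<sigma> l (fst (\<delta> l)) (snd (\<delta> l))) =
     (\<Prod>l\<in>V. \<sigma> l (fst (\<beta> l)) (snd (\<beta> l))) * (\<Prod>l\<in>W. \<sigma> l (fst (\<gamma> l)) (snd (\<gamma> l)))"
    for \<sigma> :: "nat \<Rightarrow> 'a mat_fn"
    using assms W by (subst prod.union_disjoint) (auto simp: \<delta>_def intro!: arg_cong2[of _ _ _ _
        "(*)"] prod.cong)
  ultimately show ?thesis
    by (auto simp: coord_prod_def fun_eq_iff intro!: image_eqI[of _ _ \<delta>])
qed

text \<open>Induction on the monomial: a variable falls under the trichotomy of entries, and both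
  products in a supercommutator expand over an intermediate index.\<close>

lemma seval_lin:
  assumes "distinct (leaves m)" "set (leaves m) \<subseteq> {..<n}"
  shows "(\<lambda>\<sigma>. if gr_subst kd t k n \<sigma> then fst (seval (2*t) k \<sigma> m) p q else (0::'a::field_char_0))
     \<in> lin_comb (coord_prod kd t k n (set (leaves m)) ` paths t k (set (leaves m)) p q)"
  using assms
proof (induction m arbitrary: p q)
  case (Var v)
  have v: "gr_subst kd t k n \<sigma> \<Longrightarrow> \<sigma> v \<in> S_part kd t (\<not> v < k)" for \<sigma> :: "nat \<Rightarrow> 'a mat_fn"
    using Var by (auto simp: gr_subst_def S_part_def)
  show ?case
  proof (cases kd t "\<not> v < k" p q rule: S_entry_cases[where ?'a = 'a])
    case zero
    then have "(\<lambda>\<sigma>. if gr_subst kd t k n \<sigma> then fst (seval (2*t) k \<sigma> (Var v)) p q else (0::'a)) =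
        (\<lambda>_. 0)"
      using v by (auto simp: fun_eq_iff)
    then show ?thesis by (simp only: lin_zero)
  next
    case strict
    have "{l. l = v \<and> (p,q) \<in> strict_pos t} = {v}" using strict by auto
    then have "(\<lambda>_. (p, q)) \<in> paths t k {v} p q"
      using strict by (auto simp: paths_def strict_pos_def)
    moreover have "(\<lambda>\<sigma>. if gr_subst kd t k n \<sigma> then fst (seval (2*t) k \<sigma> (Var v)) p q else (0::'a))
       = coord_prod kd t k n {v} (\<lambda>_. (p, q))"
      by (auto simp: fun_eq_iff coord_prod_def)
    ultimately show ?thesis by (auto intro!: lin_base)
  next
    case (flat c \<beta>)
    have "{l. l = v \<and> \<beta> \<in> strict_pos t} = {}"
      using flat flat_strict_disjoint by auto
    then have "(\<lambda>_. \<beta>) \<in> paths t k {v} p q"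
      using flat by (auto simp: paths_def)
    moreover have "(\<lambda>\<sigma>. if gr_subst kd t k n \<sigma> then fst (seval (2*t) k \<sigma> (Var v)) p q else (0::'a))
       = (\<lambda>\<sigma>. c * coord_prod kd t k n {v} (\<lambda>_. \<beta>) \<sigma>)"
      using flat(5) v by (auto simp: fun_eq_iff coord_prod_def)
    ultimately show ?thesis by (simp add: lin_scale lin_base)
  qed
next
  case (Mul a b)
  let ?V = "set (leaves a)" and ?W = "set (leaves b)"
  let ?e = "\<lambda>m p q \<sigma>. if gr_subst kd t k n \<sigma> then fst (seval (2*t) k \<sigma> m) p q else (0::'a)"
  let ?G = "\<lambda>V p q. coord_prod kd t k n V ` paths t k V p q"
  have d: "distinct (leaves a)" "distinct (leaves b)" "?V \<inter> ?W = {}" "?V \<subseteq> {..<n}" "?W \<subseteq> {..<n}"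
    using Mul.prems by auto
  note a = Mul.IH(1)[OF d(1,4)] and b = Mul.IH(2)[OF d(2,5)]
  have 1: "(\<lambda>\<sigma>. ?e a p l \<sigma> * ?e b l q \<sigma>) \<in> lin_comb (?G (?V \<union> ?W) p q)" for l
    by (rule lin_mult[OF a b]) (use d in \<open>auto intro!: coord_prod_mult\<close>)
  have 2: "(\<lambda>\<sigma>. ?e b p l \<sigma> * ?e a l q \<sigma>) \<in> lin_comb (?G (?W \<union> ?V) p q)" for l
    by (rule lin_mult[OF b a]) (use d in \<open>auto intro!: coord_prod_mult\<close>)
  have "?e (Mul a b) p q = (\<lambda>\<sigma>. (\<Sum>l<2*t. ?e a p l \<sigma> * ?e b l q \<sigma>)
      + (if spar k a \<and> spar k b then 1 else -1) * (\<Sum>l<2*t. ?e b p l \<sigma> * ?e a l q \<sigma>))"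
    by (rule ext) (simp only: fst_seval_Mul if_distrib if_True if_False mult_zero_left
        sum.neutral_const mult_zero_right add_0_right split: if_split, simp)
  also have "\<dots> \<in> lin_comb (?G (?V \<union> ?W) p q)"
    using 1 2 by (intro lin_add lin_scale lin_sum) (simp_all add: Un_commute)
  finally show ?case by simp
qed

section \<open>A finite spanning set for the monomial functions\<close>

text \<open>Paths with their endpoints forgotten, made extensional so that there are finitely many.
  The bound on the strict positions is what remains of the rank inequality, since ranks are at most
  \<open>2 * t\<close>.\<close>

definition choices :: "nat \<Rightarrow> nat \<Rightarrow> nat \<Rightarrow> (nat \<Rightarrow> nat \<times> nat) set" where
  "choices t k n = {\<beta> \<in> Pi\<^sub>E {..<n} (\<lambda>l. strict_pos t \<union> flat_pos t (\<not> l < k)).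
      card {l\<in>{..<n}. \<beta> l \<in> strict_pos t} \<le> 2 * t}"

lemma finite_choices: "finite (choices t k n)"
proof (rule finite_subset)
  show "choices t k n \<subseteq> Pi\<^sub>E {..<n} (\<lambda>l. strict_pos t \<union> flat_pos t (\<not> l < k))"
    by (auto simp: choices_def)
qed (auto intro!: finite_PiE)

lemma coord_prod_paths_subset:
  "coord_prod kd t k n {..<n} ` paths t k {..<n} p q \<subseteq> coord_prod kd t k n {..<n} ` choices t k n"
proof
  fix g assume "g \<in> coord_prod kd t k n {..<n} ` paths t k {..<n} p q"
  then obtain \<beta> where \<beta>: "\<beta> \<in> paths t k {..<n} p q" "g = coord_prod kd t k n {..<n} \<beta>" by auto
  have "{l \<in> {..<n}. restrict \<beta> {..<n} l \<in> strict_pos t} = {l \<in> {..<n}. \<beta> l \<in> strict_pos t}" by auto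
  moreover have "card {l \<in> {..<n}. \<beta> l \<in> strict_pos t} \<le> 2 * t"
    using \<beta>(1) rank_bound[of q t] by (auto simp: paths_def)
  ultimately have "restrict \<beta> {..<n} \<in> choices t k n"
    using \<beta>(1) unfolding choices_def paths_def by auto
  moreover have "g = coord_prod kd t k n {..<n} (restrict \<beta> {..<n})"
    unfolding \<beta>(2) coord_prod_def by (auto simp: fun_eq_iff intro!: prod.cong)
  ultimately show "g \<in> coord_prod kd t k n {..<n} ` choices t k n" by auto
qed

definition at_entry :: "nat \<Rightarrow> nat \<Rightarrow> ('b \<Rightarrow> 'a::field) \<Rightarrow> 'b \<Rightarrow> 'a mat_fn" where
  "at_entry p q f = (\<lambda>\<sigma> i j. if i = p \<and> j = q then f \<sigma> else 0)"

lemma at_entry_lin: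
  assumes "f \<in> lin_comb G" shows "at_entry p q f \<in> fs.span (at_entry p q ` G)"
  using assms
proof induction
  case lin_zero
  have "at_entry p q (\<lambda>_. 0) = (0 :: (nat \<Rightarrow> 'a mat_fn) \<Rightarrow> 'a mat_fn)"
    by (auto simp: at_entry_def fun_eq_iff)
  then show ?case by (simp only: fs.span_zero)
next
  case (lin_step g f c)
  have "at_entry p q (\<lambda>x. c * g x + f x) = fscale c (at_entry p q g) + at_entry p q f"
    by (auto simp: at_entry_def fun_eq_iff fscale_def)
  moreover have "at_entry p q g \<in> fs.span (at_entry p q ` G)"
    using lin_step(1) by (intro fs.span_base imageI)
  ultimately show ?case using lin_step(3)
    by (simp only: fs.span_add fs.span_scale)
qed

lemma sum_fun_apply: "(\<Sum>a\<in>A. f a) x = (\<Sum>a\<in>A. f a x)"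
  by (induction A rule: infinite_finite_induct) auto

definition spanning :: "inv_kind \<Rightarrow> nat \<Rightarrow> nat \<Rightarrow> nat \<Rightarrow> ((nat \<Rightarrow> 'a::field mat_fn) \<Rightarrow> 'a mat_fn) set" where
  "spanning kd t k n = (\<lambda>((p, q), \<beta>). at_entry p q (coord_prod kd t k n {..<n} \<beta>)) `
     (({..<2*t} \<times> {..<2*t}) \<times> choices t k n)"

text \<open>The matrix value is split into its single entries, each of which is a combination of
  coordinate products.\<close>

lemma mon_fun_in_span:
  assumes "m \<in> multilin n"
  shows "(mon_fun kd t k n m :: (nat \<Rightarrow> 'a::field_char_0 mat_fn) \<Rightarrow> _) \<in> fs.span (spanning kd t k n)"
proof -
  let ?e = "\<lambda>p q \<sigma>. if gr_subst kd t k n \<sigma> then fst (seval (2*t) k \<sigma> m) p q else (0::'a)"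
  have m: "distinct (leaves m)" "set (leaves m) = {..<n}"
    using assms by (auto simp: multilin_def)
  have lin_comb: "?e p q \<in> lin_comb (coord_prod kd t k n {..<n} ` paths t k {..<n} p q)" for p q
    using seval_lin[of m n kd t k p q] m by simp
  \<comment> \<open>Outside the square of size \<open>2 * t\<close> there are no paths, so the entry
    is an empty combination.\<close>
  have out: "?e p q = (\<lambda>_. 0)" if "\<not> (p < 2*t \<and> q < 2*t)" for p q
  proof -
    have "paths t k {..<n} p q = {}" using that by (auto simp: paths_def)
    then show ?thesis using lin_comb[of p q] by (intro lin_empty) simp
  qed
  have eq: "mon_fun kd t k n m = (\<Sum>(p,q)\<in>{..<2*t} \<times> {..<2*t}. at_entry p q (?e p q))"
  proof (intro ext)
    fix \<sigma> :: "nat \<Rightarrow> 'a mat_fn" and i j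
    have *: "(case x of (p, q) \<Rightarrow> at_entry p q (?e p q)) \<sigma> i j = (if x = (i, j) then ?e i j \<sigma> else
        0)" for x
      by (cases x) (simp add: at_entry_def)
    have "(\<Sum>(p,q)\<in>{..<2*t} \<times> {..<2*t}. at_entry p q (?e p q)) \<sigma> i j
        = (\<Sum>x\<in>{..<2*t} \<times> {..<2*t}. if x = (i, j) then ?e i j \<sigma> else 0)"
      unfolding sum_fun_apply * ..
    also have "\<dots> = ?e i j \<sigma>"
      using fun_cong[OF out[of i j], of \<sigma>] by (auto simp: sum.delta)
    also have "\<dots> = mon_fun kd t k n m \<sigma> i j" by (simp add: mon_fun_def)
    finally show "mon_fun kd t k n m \<sigma> i j
        = (\<Sum>(p,q)\<in>{..<2*t} \<times> {..<2*t}. at_entry p q (?e p q)) \<sigma> i j" by simp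
  qed
  have "at_entry p q (?e p q) \<in> fs.span (spanning kd t k n)" if "p < 2*t" "q < 2*t" for p q
  proof -
    have "at_entry p q (?e p q) \<in> fs.span (at_entry p q ` (coord_prod kd t k n {..<n} ` choices t k n))"
      by (rule at_entry_lin[OF lin_mono[OF lin_comb coord_prod_paths_subset]])
    also have "\<dots> \<subseteq> fs.span (spanning kd t k n)"
    proof (rule fs.span_mono, safe)
      fix \<beta> assume "\<beta> \<in> choices t k n"
      then show "at_entry p q (coord_prod kd t k n {..<n} \<beta>) \<in> spanning kd t k n"
        using that unfolding spanning_def by (intro image_eqI[of _ _ "((p, q), \<beta>)"]) auto
    qed
    finally show ?thesis .
  qed
  then show ?thesis unfolding eq by (intro fs.span_sum) auto
qed

lemma finite_spanning: "finite (spanning kd t k n)"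
  by (simp add: spanning_def finite_choices)

lemma card_spanning: "card (spanning kd t k n) \<le> (2*t)^2 * card (choices t k n)"
  unfolding spanning_def
  by (rule order_trans[OF card_image_le]) (auto simp: finite_choices power2_eq_square
      card_cartesian_product)

lemma ccodim_le: "ccodim TYPE('a::field_char_0) kd t k n \<le> (2*t)^2 * card (choices t k n)"
  unfolding ccodim_def
  by (rule order_trans[OF fs.dim_le_card card_spanning])
     (auto intro: mon_fun_in_span simp: finite_spanning)

section \<open>Counting the choices of positions\<close>

lemma power_one_plus_inverse_le: "(1 + 1 / real (Suc n)) ^ n \<le> 3"
proof -
  have "(1 + 1 / real (Suc n)) ^ n \<le> exp (1 / real (Suc n)) ^ n"
    by (intro power_mono exp_ge_add_one_self) simp
  also have "\<dots> = exp (real n * (1 / real (Suc n)))" by (simp only: exp_of_nat_mult)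
  also have "\<dots> \<le> exp 1" by simp
  also have "\<dots> \<le> 3" by (rule exp_le)
  finally show ?thesis .
qed

text \<open>Weighting every strict position by a small \<open>x\<close> turns the count into the product
  \<open>\<Prod>l<n. (b\<^sub>l + D x)\<close>; the choice \<open>x = 1 / (D (n + 1))\<close> keeps this within a factor 3 of
  \<open>\<Prod>l<n. b\<^sub>l\<close>.\<close>
lemma card_choices_le:
  assumes "t \<ge> 2" "k \<le> n"
  defines "D \<equiv> card (strict_pos t) + 1"
  shows "real (card (choices t k n)) \<le> 3 * (real D * real (Suc n)) ^ (2*t) * real t ^ k * real (2
      * (t div 2)) ^ (n - k)"
proof -
  define x where "x = 1 / (real D * real (Suc n))"
  define b where "b l = card (flat_pos t (\<not> l < k))" for l
  have x: "0 < x" "x \<le> 1"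
    unfolding x_def D_def by (simp, intro divide_le_eq_1_pos[THEN iffD2], simp_all) (simp add:
        algebra_simps)
  \<comment> \<open>This bounds \<open>b l + 1 / (n + 1)\<close> by
    \<open>b l (1 + 1 / (n + 1))\<close> below; \<open>t \<ge> 2\<close> provides flat positions for
    odd variables too.\<close>
  have b: "b l \<ge> 1" for l using assms by (auto simp: b_def card_flat_pos)
  define w where "w \<beta> = (if \<beta> \<in> strict_pos t then x else 1)" for \<beta>
  let ?A = "\<lambda>l. strict_pos t \<union> flat_pos t (\<not> l < k)"
  have "x ^ (2*t) * real (card (choices t k n)) = (\<Sum>\<beta>\<in>choices t k n. x ^ (2*t))" by simp
  \<comment> \<open>At most \<open>2 * t\<close> of the weights are \<open>x\<close>, the others are
    1, and \<open>x \<le> 1\<close>.\<close>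
  also have "\<dots> \<le> (\<Sum>\<beta>\<in>choices t k n. \<Prod>l\<in>{..<n}. w (\<beta> l))"
  proof (rule sum_mono)
    fix \<beta> assume \<beta>: "\<beta> \<in> choices t k n"
    have "(\<Prod>l\<in>{..<n}. w (\<beta> l)) = x ^ card {l\<in>{..<n}. \<beta> l \<in> strict_pos t}"
        unfolding w_def by (simp add: prod.If_cases Int_def)
    then show "x ^ (2*t) \<le> (\<Prod>l\<in>{..<n}. w (\<beta> l))"
      using power_decreasing[of "card {l\<in>{..<n}. \<beta> l \<in> strict_pos t}" "2*t" x] \<beta> x
      by (simp add: choices_def)
  qed
  also have "\<dots> \<le> (\<Sum>\<beta>\<in>Pi\<^sub>E {..<n} ?A. \<Prod>l\<in>{..<n}. w (\<beta> l))"
  proof (rule sum_mono2)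
    show "choices t k n \<subseteq> Pi\<^sub>E {..<n} ?A" by (auto simp: choices_def)
    show "0 \<le> (\<Prod>l\<in>{..<n}. w (\<beta> l))" for \<beta>
      using x by (intro prod_nonneg) (simp add: w_def)
  qed (auto intro!: finite_PiE)
  \<comment> \<open>With the restriction on strict positions dropped, the sum of the weights factors
    over the variables.\<close>
  also have "\<dots> = (\<Prod>l\<in>{..<n}. \<Sum>\<beta>\<in>?A l. w \<beta>)"
    by (rule prod_sum_PiE[symmetric]) auto
  also have "\<dots> \<le> (\<Prod>l\<in>{..<n}. real (b l) * (1 + 1 / real (Suc n)))"
  proof (rule prod_mono, safe)
    fix l
    show "0 \<le> (\<Sum>\<beta>\<in>?A l. w \<beta>)" using x by (auto simp: w_def intro!: sum_nonneg)
    have "(\<Sum>\<beta>\<in>?A l. w \<beta>) = (\<Sum>\<beta>\<in>strict_pos t. w \<beta>) + (\<Sum>\<beta>\<in>flat_pos t (\<not> l < k). w \<beta>)"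
      using flat_strict_disjoint[of t "\<not> l < k"] by (intro sum.union_disjoint) auto
    also have "(\<Sum>\<beta>\<in>strict_pos t. w \<beta>) = card (strict_pos t) * x" by (simp add: w_def)
    also have "(\<Sum>\<beta>\<in>flat_pos t (\<not> l < k). w \<beta>) = (\<Sum>\<beta>\<in>flat_pos t (\<not> l < k). 1)"
      using flat_strict_disjoint[of t "\<not> l < k"] by (intro sum.cong) (auto simp: w_def)
    also have "\<dots> = real (b l)" by (simp add: b_def)
    also have "card (strict_pos t) * x \<le> 1 / real (Suc n)"
    proof -
      have "card (strict_pos t) * x \<le> real D * x"
        using x by (intro mult_right_mono) (auto simp: D_def)
      also have "real D * x = 1 / real (Suc n)"
        by (simp add: x_def D_def)
      finally show ?thesis .
    qed
    also have "1 / real (Suc n) + real (b l) \<le> real (b l) * (1 + 1 / real (Suc n))"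
      using mult_right_mono[of 1 "real (b l)" "1 / real (Suc n)"] b[of l]
      by (simp add: distrib_left)
    finally show "(\<Sum>\<beta>\<in>?A l. w \<beta>) \<le> real (b l) * (1 + 1 / real (Suc n))" by simp
  qed
  also have "\<dots> = (\<Prod>l\<in>{..<n}. real (b l)) * (1 + 1 / real (Suc n)) ^ n"
    by (simp add: prod.distrib)
  also have "\<dots> \<le> (\<Prod>l\<in>{..<n}. real (b l)) * 3"
    by (intro mult_left_mono power_one_plus_inverse_le prod_nonneg) auto
  also have "(\<Prod>l\<in>{..<n}. real (b l)) = real t ^ k * real (2 * (t div 2)) ^ (n - k)"
  proof -
    have "{..<n} = {..<k} \<union> {k..<n}" using assms(2) by auto
    then have "(\<Prod>l\<in>{..<n}. real (b l)) = (\<Prod>l\<in>{..<k}. real (b l)) * (\<Prod>l\<in>{k..<n}. real (b l))"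
      using prod.union_disjoint[of "{..<k}" "{k..<n}" "\<lambda>l. real (b l)"]
      by (metis finite_lessThan finite_atLeastLessThan ivl_disj_int_one(2))
    also have "(\<Prod>l\<in>{..<k}. real (b l)) = (\<Prod>l\<in>{..<k}. real t)"
      by (intro prod.cong) (auto simp: b_def card_flat_pos)
    also have "(\<Prod>l\<in>{k..<n}. real (b l)) = (\<Prod>l\<in>{k..<n}. real (2 * (t div 2)))"
      by (intro prod.cong) (auto simp: b_def card_flat_pos)
    finally show ?thesis by simp
  qed
  finally have "x ^ (2*t) * real (card (choices t k n)) \<le> real t ^ k * real (2 * (t div 2)) ^ (n -
      k) * 3" .
  moreover have one: "(real D * real (Suc n)) ^ (2*t) * x ^ (2*t) = 1"
    unfolding power_mult_distrib[symmetric] by (simp add: x_def D_def)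
  ultimately have "(real D * real (Suc n)) ^ (2*t) * (x ^ (2*t) * real (card (choices t k n)))
      \<le> (real D * real (Suc n)) ^ (2*t) * (real t ^ k * real (2 * (t div 2)) ^ (n - k) * 3)"
    by (intro mult_left_mono) auto
  then show ?thesis
    unfolding mult.assoc[symmetric] one by (simp only: mult_1_left mult.commute[of _ 3] mult.assoc)
qed

text \<open>Summed over the number \<open>k\<close> of even variables, the bounds on
  \<open>ccodim\<close> form a binomial expansion whose value is the power of
  \<open>t + 2 (t div 2)\<close>.\<close>

lemma gr_codim_upper:
  assumes "t \<ge> 2"
  obtains C :: real where "C > 0"
    "\<And>n. real (gr_codim TYPE('a::field_char_0) kd t n) \<le> C * real (Suc n) ^ (2*t) * real (t + 2 *
        (t div 2)) ^ n"
proof -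
  define D where "D = card (strict_pos t) + 1"
  define C where "C = real ((2*t)^2) * 3 * real D ^ (2*t)"
  have "real (gr_codim TYPE('a) kd t n) \<le> C * real (Suc n) ^ (2*t) * real (t + 2 * (t div 2)) ^ n" for n
  proof -
    have "real (gr_codim TYPE('a) kd t n) = (\<Sum>k\<le>n. real (n choose k) * real (ccodim TYPE('a) kd t k n))"
      by (simp add: gr_codim_def)
    also have "\<dots> \<le> (\<Sum>k\<le>n. real (n choose k) * (C * real (Suc n) ^ (2*t) * real t ^ k * real (2 *
        (t div 2)) ^ (n - k)))"
    proof (intro sum_mono mult_left_mono)
      fix k assume "k \<in> {..n}"
      have "real (ccodim TYPE('a) kd t k n) \<le> real ((2*t)^2) * real (card (choices t k n))"
        using ccodim_le[where ?'a = 'a, of kd t k n] unfolding of_nat_mult[symmetric] of_nat_le_iff .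
      also have "\<dots> \<le> real ((2*t)^2) * (3 * (real D * real (Suc n)) ^ (2*t) * real t ^ k * real (2
          * (t div 2)) ^ (n - k))"
        using card_choices_le[OF assms, of k n] \<open>k \<in> {..n}\<close> unfolding D_def
        by (intro mult_left_mono) auto
      finally show "real (ccodim TYPE('a) kd t k n) \<le> C * real (Suc n) ^ (2*t) * real t ^ k * real
          (2 * (t div 2)) ^ (n - k)"
        by (simp add: C_def power_mult_distrib mult_ac)
    qed simp
    also have "\<dots> = C * real (Suc n) ^ (2*t) * (\<Sum>k\<le>n. real (n choose k) * real t ^ k * real (2 * (t
        div 2)) ^ (n - k))"
      by (simp add: sum_distrib_left mult_ac)
    also have "(\<Sum>k\<le>n. real (n choose k) * real t ^ k * real (2 * (t div 2)) ^ (n - k)) = real (t +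
        2 * (t div 2)) ^ n"
      by (simp only: of_nat_add binomial_ring)
    finally show ?thesis .
  qed
  moreover have "C > 0" using assms by (simp add: C_def D_def)
  ultimately show ?thesis using that by blast
qed

section \<open>Products of block matrices\<close>

text \<open>The supercommutator on pairs of a matrix and its parity; left-normed monomials become
  left folds of it.\<close>

definition sbracket :: "nat \<Rightarrow> 'a::field mat_fn \<times> bool \<Rightarrow> 'a mat_fn \<times> bool \<Rightarrow> 'a mat_fn \<times> bool" where
  "sbracket N S L = ((\<lambda>i j. mmul N (fst S) (fst L) i j
      - (if snd S \<and> snd L then -1 else 1) * mmul N (fst L) (fst S) i j), snd S \<noteq> snd L)"

definition scale_state :: "'a::field \<Rightarrow> 'a mat_fn \<times> bool \<Rightarrow> 'a mat_fn \<times> bool" where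
  "scale_state c S = ((\<lambda>i j. c * fst S i j), snd S)"

abbreviation zmat :: "'a::field mat_fn" where "zmat \<equiv> (\<lambda>_ _. 0)"

lemma seval_Mul_sbracket: "seval N k \<sigma> (Mul a b) = sbracket N (seval N k \<sigma> a) (seval N k \<sigma> b)"
  by (auto simp: sbracket_def split: prod.splits)

lemma sbracket_scale_state: "sbracket N (scale_state c S) L = scale_state c (sbracket N S L)"
  by (auto simp: sbracket_def scale_state_def mmul_def fun_eq_iff algebra_simps sum_distrib_left)

lemma scale_state_scale_state: "scale_state c (scale_state d S) = scale_state (c * d) S"
  by (simp add: scale_state_def mult.assoc)

definition even_elt :: "inv_kind \<Rightarrow> nat \<Rightarrow> 'a::field mat_fn \<Rightarrow> 'a mat_fn" where
  "even_elt kd t x = blk t x zmat zmat (\<lambda>i j. - invol kd t x i j)"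

definition odd_elt :: "nat \<Rightarrow> 'a::field mat_fn \<Rightarrow> 'a mat_fn \<Rightarrow> 'a mat_fn" where
  "odd_elt t y z = blk t zmat y z zmat"

definition unit_mat :: "nat \<Rightarrow> nat \<Rightarrow> 'a::field mat_fn" where
  "unit_mat i j = (\<lambda>a b. if a = i \<and> b = j then 1 else 0)"

definition diag_mat :: "nat \<Rightarrow> (nat \<Rightarrow> 'a::field) \<Rightarrow> 'a mat_fn" where
  "diag_mat t f = (\<lambda>a b. if a = b \<and> a < t then f a else 0)"

definition bar :: "nat \<Rightarrow> nat \<Rightarrow> nat" where "bar t i = t - 1 - i"

lemma sum_split_double:
  fixes f :: "nat \<Rightarrow> 'a::comm_monoid_add"
  shows "(\<Sum>l<2*t. f l) = (\<Sum>l<t. f l) + (\<Sum>l<t. f (t + l))"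
proof -
  have "(\<Sum>l<2*t. f l) = (\<Sum>l\<in>{0..<t}. f l) + (\<Sum>l\<in>{t..<t+t}. f l)"
    by (simp add: lessThan_atLeast0 mult_2 sum.atLeastLessThan_concat)
  also have "(\<Sum>l\<in>{t..<t+t}. f l) = (\<Sum>l<t. f (t + l))"
    using sum.shift_bounds_nat_ivl[of f 0 t t] by (simp add: lessThan_atLeast0 add.commute)
  finally show ?thesis by (simp add: lessThan_atLeast0)
qed

lemma blk_eqI:
  assumes "\<And>i j. i < t \<Longrightarrow> j < t \<Longrightarrow> x i j = x' i j \<and> y i j = y' i j \<and> z i j = z' i j \<and> w i j = w' i j"
  shows "blk t x y z w = blk t x' y' z' w'"
  using assms by (auto simp: blk_def fun_eq_iff)

lemma mmul_blk:
  "mmul (2*t) (blk t x y z w) (blk t x' y' z' w') =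
    blk t (\<lambda>i j. mmul t x x' i j + mmul t y z' i j) (\<lambda>i j. mmul t x y' i j + mmul t y w' i j)
          (\<lambda>i j. mmul t z x' i j + mmul t w z' i j) (\<lambda>i j. mmul t z y' i j + mmul t w w' i j)"
    (is "?l = ?r")
proof (intro ext)
  fix p q
  show "?l p q = ?r p q"
  proof (cases p t rule: index_split)
    case out then show ?thesis by (auto simp: mmul_def blk_def)
  next
    case low
    then show ?thesis
      by (cases q t rule: index_split)
        (auto simp: mmul_def sum_split_double blk_entry, auto simp: blk_def)
  next
    case (high p')
    then show ?thesis
      by (cases q t rule: index_split)
        (auto simp: mmul_def sum_split_double blk_entry, auto simp: blk_def)
  qed
qed

lemma blk_lincomb:
  "(\<lambda>i j. blk t x y z w i j - c * blk t x' y' z' w' i j) =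
    blk t (\<lambda>i j. x i j - c * x' i j) (\<lambda>i j. y i j - c * y' i j)
          (\<lambda>i j. z i j - c * z' i j) (\<lambda>i j. w i j - c * w' i j)"
  by (auto simp: blk_def fun_eq_iff)

lemma scale_state_blk:
  "scale_state c (blk t x y z w, p) = (blk t (\<lambda>i j. c * x i j) (\<lambda>i j. c * y i j) (\<lambda>i j. c * z i j)
      (\<lambda>i j. c * w i j), p)"
  by (auto simp: scale_state_def blk_def fun_eq_iff)

lemma mmul_zero [simp]: "mmul N zmat A = zmat" "mmul N A zmat = zmat"
  by (simp_all add: mmul_def)

lemma mmul_neg [simp]:
  "mmul N (\<lambda>i j. - A i j) B = (\<lambda>i j. - mmul N A B i j)"
  "mmul N A (\<lambda>i j. - B i j) = (\<lambda>i j. - mmul N A B i j)"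
  by (simp_all add: mmul_def sum_negf)

section \<open>The involution and supercommutators in block form\<close>

lemma bar_less: "i < t \<Longrightarrow> bar t i < t" by (simp add: bar_def)

lemma invol_bar:
  "invol kd t X = (\<lambda>i j. if i < t \<and> j < t then
     (case kd of Orth \<Rightarrow> X (bar t j) (bar t i)
      | Symp \<Rightarrow> sgnD t i * sgnD t j * X (bar t j) (bar t i)) else 0)"
  by (simp add: invol_def bar_def fun_eq_iff split: inv_kind.split)

lemma sum_reflect:
  fixes f :: "nat \<Rightarrow> 'a::comm_monoid_add"
  shows "(\<Sum>l<t. f (bar t l)) = (\<Sum>l<t. f l)"
  using sum.nat_diff_reindex[of f t] by (simp add: bar_def)

text \<open>Reflecting the summation index reverses the factors; in the symplectic case the square
  of \<open>sgnD t l\<close> is inserted as 1.\<close>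

lemma invol_mmul:
  assumes "i < t" "j < t"
  shows "invol kd t (mmul t x y) i j = mmul t (invol kd t y) (invol kd t x) i j"
proof (cases kd)
  case Orth
  have "invol kd t (mmul t x y) i j = (\<Sum>l<t. x (bar t j) (bar t l) * y (bar t l) (bar t i))"
    using assms Orth sum_reflect[of "\<lambda>l. x (bar t j) l * y l (bar t i)" t]
    by (simp add: invol_bar mmul_def)
  also have "\<dots> = mmul t (invol kd t y) (invol kd t x) i j"
    using assms Orth by (auto simp: mmul_def invol_bar mult.commute intro!: sum.cong)
  finally show ?thesis .
next
  case Symp
  have "invol kd t (mmul t x y) i j = sgnD t i * sgnD t j * (\<Sum>l<t. x (bar t j) (bar t l) * y (bar
      t l) (bar t i))"
    using assms Symp sum_reflect[of "\<lambda>l. x (bar t j) l * y l (bar t i)" t]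
    by (simp add: invol_bar mmul_def)
  also have "\<dots> = (\<Sum>l<t. sgnD t l * sgnD t l * (sgnD t i * sgnD t j * (x (bar t j) (bar t l) * y
      (bar t l) (bar t i))))"
    by (simp add: sgnD_square sum_distrib_left)
  also have "\<dots> = mmul t (invol kd t y) (invol kd t x) i j"
    using assms Symp by (auto simp: mmul_def invol_bar mult_ac intro!: sum.cong)
  finally show ?thesis .
qed

lemma invol_lincomb:
  "invol kd t (\<lambda>i j. x i j - y i j) = (\<lambda>i j. invol kd t x i j - invol kd t y i j)"
  by (auto simp: invol_def fun_eq_iff algebra_simps split: inv_kind.splits)

text \<open>The involution reverses products, so minus the involution preserves commutators and the
  lower block follows the upper one.\<close>

lemma sbracket_even_elt_even_elt:
  "sbracket (2*t) (even_elt kd t x, False) (even_elt kd t x', False) =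
     (even_elt kd t (\<lambda>i j. mmul t x x' i j - mmul t x' x i j), False)"
  unfolding sbracket_def even_elt_def
  by (auto simp: mmul_blk blk_lincomb[of _ _ _ _ _ 1, simplified] invol_lincomb invol_mmul intro!:
      blk_eqI)

lemma sbracket_even_elt_odd_elt:
  "sbracket (2*t) (even_elt kd t x, False) (odd_elt t y z, True) =
     (odd_elt t (\<lambda>i j. mmul t x y i j + mmul t y (invol kd t x) i j)
           (\<lambda>i j. - mmul t (invol kd t x) z i j - mmul t z x i j), True)"
  unfolding sbracket_def even_elt_def odd_elt_def
  by (auto simp: mmul_blk blk_lincomb[of _ _ _ _ _ 1, simplified] intro!: blk_eqI)

lemma sbracket_odd_elt_even_elt:
  "sbracket (2*t) (odd_elt t y z, True) (even_elt kd t x, False) =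
     (odd_elt t (\<lambda>i j. - mmul t x y i j - mmul t y (invol kd t x) i j)
           (\<lambda>i j. mmul t (invol kd t x) z i j + mmul t z x i j), True)"
  unfolding sbracket_def even_elt_def odd_elt_def
  by (auto simp: mmul_blk blk_lincomb[of _ _ _ _ _ 1, simplified] intro!: blk_eqI)

text \<open>The result stays a raw block matrix: it has the form \<open>even_elt\<close> only if the
  lower block is minus the involution of the upper one, which \<open>odd_state_odd_elt\<close>
  verifies for its special factors.\<close>

lemma sbracket_odd_elt_odd_elt:
  "sbracket (2*t) (odd_elt t y z, True) (odd_elt t y' z', True) =
     (blk t (\<lambda>i j. mmul t y z' i j + mmul t y' z i j) zmat zmat
            (\<lambda>i j. mmul t z y' i j + mmul t z' y i j), False)"
  unfolding sbracket_def odd_elt_def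
  by (auto simp: mmul_blk blk_lincomb[of _ _ _ _ _ "-1", simplified] intro!: blk_eqI)

section \<open>Matrix units and diagonal matrices\<close>

lemma mmul_unit_mat_left:
  assumes "j < t" shows "mmul t (unit_mat i j) B = (\<lambda>a b. if a = i then B j b else 0)"
proof (intro ext)
  fix a b
  have "mmul t (unit_mat i j) B a b = (\<Sum>l<t. if l = j then (if a = i then B j b else 0) else 0)"
    unfolding mmul_def by (intro sum.cong) (simp_all add: unit_mat_def)
  then show "mmul t (unit_mat i j) B a b = (if a = i then B j b else 0)"
    using assms by simp
qed

lemma mmul_unit_mat_right:
  assumes "i < t" shows "mmul t A (unit_mat i j) = (\<lambda>a b. if b = j then A a i else 0)"
proof (intro ext)
  fix a b
  have "mmul t A (unit_mat i j) a b = (\<Sum>l<t. if l = i then (if b = j then A a i else 0) else 0)"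
    unfolding mmul_def by (intro sum.cong) (simp_all add: unit_mat_def)
  then show "mmul t A (unit_mat i j) a b = (if b = j then A a i else 0)"
    using assms by simp
qed

lemma mmul_unit_mat_diag_mat: "j < t \<Longrightarrow> mmul t (unit_mat i j) (diag_mat t f) = (\<lambda>a b. f j *
    unit_mat i j a b)"
  unfolding mmul_unit_mat_left by (auto simp: fun_eq_iff unit_mat_def diag_mat_def)

lemma mmul_diag_mat_unit_mat: "i < t \<Longrightarrow> mmul t (diag_mat t f) (unit_mat i j) = (\<lambda>a b. f i *
    unit_mat i j a b)"
  unfolding mmul_unit_mat_right by (auto simp: fun_eq_iff unit_mat_def diag_mat_def)

lemma mmul_unit_mat_unit_mat: "j < t \<Longrightarrow> mmul t (unit_mat i j) (unit_mat k l) = (if j = k then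
    unit_mat i l else zmat)"
  unfolding mmul_unit_mat_left by (auto simp: fun_eq_iff unit_mat_def)

lemma mmul_diag_mat_diag_mat: "mmul t (diag_mat t f) (diag_mat t g) = diag_mat t (\<lambda>a. f a * g a)"
proof (intro ext)
  fix a b
  have "mmul t (diag_mat t f) (diag_mat t g) a b = (\<Sum>l<t. if l = a then f a * diag_mat t g a b else 0)"
    unfolding mmul_def by (intro sum.cong) (auto simp: diag_mat_def)
  then show "mmul t (diag_mat t f) (diag_mat t g) a b = diag_mat t (\<lambda>a. f a * g a) a b"
    by (simp add: diag_mat_def)
qed

lemma bar_eq_iff: "a < t \<Longrightarrow> b < t \<Longrightarrow> bar t b = a \<longleftrightarrow> b = bar t a"
  by (auto simp: bar_def)

lemma invol_diag_mat: "invol kd t (diag_mat t f) = diag_mat t (\<lambda>a. f (bar t a))"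
proof (intro ext)
  fix a b
  show "invol kd t (diag_mat t f) a b = diag_mat t (\<lambda>a. f (bar t a)) a b"
  proof (cases "a < t \<and> b < t")
    case True
    then have "bar t b = bar t a \<longleftrightarrow> a = b" by (auto simp: bar_def)
    then have "diag_mat t f (bar t b) (bar t a) = diag_mat t (\<lambda>a. f (bar t a)) a b"
      using True bar_less[of b t] unfolding diag_mat_def by simp
    moreover have "sgnD t a * sgnD t b * diag_mat t f (bar t b) (bar t a) = diag_mat t f (bar t b)
        (bar t a)"
      using \<open>bar t b = bar t a \<longleftrightarrow> a = b\<close> by (cases "a = b") (simp_all add: sgnD_square diag_mat_def)
    ultimately show ?thesis using True by (simp add: invol_bar split: inv_kind.split)
  next
    case False
    then have "\<not> (a = b \<and> a < t)" by auto
    with False show ?thesis by (simp only: invol_bar diag_mat_def if_False)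
  qed
qed

lemma invol_unit_mat:
  assumes "i < t" "j < t"
  shows "invol kd t (unit_mat i j :: 'a::field mat_fn) =
    (\<lambda>a b. (case kd of Orth \<Rightarrow> 1 | Symp \<Rightarrow> sgnD t (bar t j) * sgnD t (bar t i)) * unit_mat (bar t j)
        (bar t i) a b)"
proof (intro ext)
  fix a b
  show "invol kd t (unit_mat i j :: 'a mat_fn) a b =
    (case kd of Orth \<Rightarrow> 1 | Symp \<Rightarrow> sgnD t (bar t j) * sgnD t (bar t i)) * unit_mat (bar t j) (bar t
        i) a b"
  proof (cases "a < t \<and> b < t")
    case True
    then have "bar t b = i \<and> bar t a = j \<longleftrightarrow> a = bar t j \<and> b = bar t i"
      using assms bar_eq_iff[of _ t] by blast
    then have *: "unit_mat i j (bar t b) (bar t a) = (unit_mat (bar t j) (bar t i) a b :: 'a)"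
      by (simp only: unit_mat_def)
    have "sgnD t a * sgnD t b * unit_mat (bar t j) (bar t i) a b
        = sgnD t (bar t j) * sgnD t (bar t i) * (unit_mat (bar t j) (bar t i) a b :: 'a)"
      by (simp add: unit_mat_def)
    then show ?thesis using True
      by (cases kd) (simp_all only: invol_bar * if_True mult_1_left inv_kind.case simp_thms)
  next
    case False
    have "\<not> (a = bar t j \<and> b = bar t i)"
      using False assms bar_less by blast
    with False show ?thesis by (simp only: invol_bar unit_mat_def if_False mult_zero_right)
  qed
qed

text \<open>The position \<open>(i, bar i)\<close> is its own reflection, and its two indices carry
  opposite symplectic signs. Hence the matrix unit lies in \<open>R+\<close> for the orthogonal and
  in \<open>R-\<close> for the symplectic involution, which decides the block that holds the odd
  state.\<close>

lemma invol_unit_mat_bar: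
  assumes "i < t div 2" "kd = Orth \<or> (kd = Symp \<and> even t)"
  shows "invol kd t (unit_mat i (bar t i)) = (\<lambda>a b. (case kd of Orth \<Rightarrow> 1 | Symp \<Rightarrow> -1) * unit_mat i
      (bar t i) a b)"
proof -
  have "i < t" "bar t i < t" "bar t (bar t i) = i" using assms(1) by (auto simp: bar_def)
  moreover have "kd = Symp \<Longrightarrow> \<not> bar t i < t div 2" using assms by (auto simp: bar_def)
  ultimately show ?thesis using assms(1)
    by (simp add: invol_unit_mat sgnD_def split: inv_kind.splits)
qed

section \<open>Action of the letters on the states\<close>

text \<open>Among the letters \<open>HP\<close>, \<open>HQ\<close> and \<open>HM\<close> only \<open>HP i\<close> acts nontrivially on the even state of the
  pair \<open>i\<close> and only \<open>HQ i\<close> on its odd state; \<open>OA i\<close> leads from the even state to the odd one and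
  \<open>OB i\<close> back. \<open>HM\<close> and \<open>OM\<close> belong to the middle index of an odd \<open>t\<close>, and the unit matrices
  \<open>XE i j\<close> lead from one pair to the next. A \<open>Free\<close> letter may be exchanged for another one of the
  same parity by a substitution, a \<open>Con\<close> letter may not.\<close>
datatype spec = HP nat | HQ nat | HM | OA nat | OB nat | OM | XE nat nat

datatype ltr = Con (core: spec) | Free (core: spec)

fun is_odd :: "spec \<Rightarrow> bool" where
  "is_odd (OA _) = True" | "is_odd (OB _) = True" | "is_odd OM = True" | "is_odd _ = False"

text \<open>\<open>yf\<close> and \<open>zf\<close> are the diagonals of the elements of
  \<open>R+\<close> and \<open>R-\<close> that belong to the pair of \<open>j\<close> and
  \<open>bar j\<close>.\<close>

definition yf :: "nat \<Rightarrow> nat \<Rightarrow> nat \<Rightarrow> 'a::field" where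
  "yf t j a = (if a = j \<or> a = bar t j then 1 else 0)"

definition zf :: "nat \<Rightarrow> nat \<Rightarrow> nat \<Rightarrow> 'a::field" where
  "zf t j a = (if a = j then 1 else if a = bar t j then -1 else 0)"

text \<open>A diagonal \<open>f\<close> acts on the even state by \<open>f (bar i) - f i\<close> and
  on the odd state by a multiple of \<open>f i\<close> (orthogonal) or of \<open>f (bar i)\<close>
  (symplectic). The 1 is placed so that the odd state is killed and the even one is not; the
  symmetric \<open>yf\<close> does the opposite.\<close>

definition pf :: "inv_kind \<Rightarrow> nat \<Rightarrow> nat \<Rightarrow> nat \<Rightarrow> 'a::field" where
  "pf kd t j a = (if a = (case kd of Orth \<Rightarrow> bar t j | Symp \<Rightarrow> j) then 1 else 0)"

definition mf :: "nat \<Rightarrow> nat \<Rightarrow> 'a::field" where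
  "mf t a = (if a = t div 2 then 1 else 0)"

text \<open>The blocks of \<open>OA\<close> and \<open>OB\<close> are exchanged between the two
  involutions because the odd state sits in the \<open>y\<close>-block in the orthogonal and in the
  \<open>z\<close>-block in the symplectic case.\<close>

fun letter_val :: "inv_kind \<Rightarrow> nat \<Rightarrow> spec \<Rightarrow> 'a::field mat_fn" where
  "letter_val kd t (HP j) = even_elt kd t (diag_mat t (pf kd t j))"
| "letter_val kd t (HQ j) = even_elt kd t (diag_mat t (yf t j))"
| "letter_val kd t HM = even_elt kd t (diag_mat t (mf t))"
| "letter_val kd t (OA j) = (case kd of Orth \<Rightarrow> odd_elt t (diag_mat t (yf t j)) (diag_mat t (\<lambda>_. 0))
                               | Symp \<Rightarrow> odd_elt t (diag_mat t (\<lambda>_. 0)) (diag_mat t (zf t j)))"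
| "letter_val kd t (OB j) = (case kd of Orth \<Rightarrow> odd_elt t (diag_mat t (\<lambda>_. 0)) (diag_mat t (zf t j))
                               | Symp \<Rightarrow> odd_elt t (diag_mat t (yf t j)) (diag_mat t (\<lambda>_. 0)))"
| "letter_val kd t OM = odd_elt t (diag_mat t (mf t)) (diag_mat t (\<lambda>_. 0))"
| "letter_val kd t (XE i j) = even_elt kd t (unit_mat i j)"

definition letter :: "inv_kind \<Rightarrow> nat \<Rightarrow> spec \<Rightarrow> 'a::field mat_fn \<times> bool" where
  "letter kd t u = (letter_val kd t u, is_odd u)"

definition even_state :: "inv_kind \<Rightarrow> nat \<Rightarrow> nat \<Rightarrow> 'a::field mat_fn \<times> bool" where
  "even_state kd t i = (even_elt kd t (unit_mat i (bar t i)), False)"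

definition odd_state :: "inv_kind \<Rightarrow> nat \<Rightarrow> nat \<Rightarrow> 'a::field mat_fn \<times> bool" where
  "odd_state kd t i = ((case kd of Orth \<Rightarrow> odd_elt t (unit_mat i (bar t i)) zmat | Symp \<Rightarrow> odd_elt t
      zmat (unit_mat i (bar t i))), True)"

definition inv_ok :: "inv_kind \<Rightarrow> nat \<Rightarrow> bool" where
  "inv_ok kd t \<longleftrightarrow> kd = Orth \<or> (kd = Symp \<and> even t)"

lemma even_elt_scale: "even_elt kd t (\<lambda>i j. c * x i j) = (\<lambda>i j. c * even_elt kd t x i j)"
  by (auto simp: even_elt_def blk_def invol_def fun_eq_iff split: inv_kind.splits)

lemma odd_elt_scale: "odd_elt t (\<lambda>i j. c * x i j) zmat = (\<lambda>i j. c * odd_elt t x zmat i j)"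
  "odd_elt t zmat (\<lambda>i j. c * x i j) = (\<lambda>i j. c * odd_elt t zmat x i j)"
  by (auto simp: odd_elt_def blk_def fun_eq_iff)

lemma odd_elt_zero: "odd_elt t zmat zmat = zmat"
  by (simp add: odd_elt_def blk_def fun_eq_iff)

lemma diag_mat_zero: "diag_mat t (\<lambda>_. 0) = zmat"
  by (auto simp: diag_mat_def)

lemma yf_bar: "i < t \<Longrightarrow> j < t \<Longrightarrow> yf t j (bar t i) = yf t j i"
  unfolding yf_def bar_def by (intro if_cong) auto

lemma low_facts:
  assumes "i < t div 2"
  shows "i < t" "bar t i < t" "bar t (bar t i) = i" "i \<noteq> bar t i" "bar t i \<noteq> i"
  using assms by (auto simp: bar_def)

text \<open>A matrix unit is an eigenvector under commutation with diagonal matrices, its weight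
  being a difference of two diagonal entries.\<close>

lemma even_state_diag:
  assumes "i < t div 2"
  shows "sbracket (2*t) (even_state kd t i) (even_elt kd t (diag_mat t f), False) = scale_state (f
      (bar t i) - f i) (even_state kd t i)"
  unfolding even_state_def scale_state_def sbracket_even_elt_even_elt
  by (simp only: mmul_unit_mat_diag_mat mmul_diag_mat_unit_mat low_facts[OF assms]
      left_diff_distrib[symmetric] even_elt_scale fst_conv snd_conv)

text \<open>For symmetric \<open>f\<close> and antisymmetric \<open>g\<close> the sign
  \<open>e\<close> doubles one block and cancels the other: \<open>y\<close> survives for
  \<open>e = 1\<close> and \<open>z\<close> for \<open>e = -1\<close>.\<close>

lemma even_state_odd_elt:
  assumes "i < t div 2" "inv_ok kd t"
  shows "sbracket (2*t) (even_state kd t i) (odd_elt t (diag_mat t f) (diag_mat t g), True) =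
    (let e = (case kd of Orth \<Rightarrow> 1 | Symp \<Rightarrow> -1) in
     (odd_elt t (\<lambda>a b. (f (bar t i) + e * f i) * unit_mat i (bar t i) a b)
           (\<lambda>a b. - (g i + e * g (bar t i)) * unit_mat i (bar t i) a b), True))"
proof -
  define e :: 'a where "e = (case kd of Orth \<Rightarrow> 1 | Symp \<Rightarrow> -1)"
  have inv: "invol kd t (unit_mat i (bar t i)) = (\<lambda>a b. e * unit_mat i (bar t i) a b)"
    unfolding e_def using assms by (intro invol_unit_mat_bar) (auto simp: inv_ok_def)
  have 1: "mmul t (diag_mat t f) (\<lambda>a b. e * unit_mat i (bar t i) a b)
      = (\<lambda>a b. e * f i * unit_mat i (bar t i) a b)" for f
  proof -
    have "mmul t (diag_mat t f) (\<lambda>a b. e * unit_mat i (bar t i) a b) = (\<lambda>a b. e * mmul t (diag_mat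
        t f) (unit_mat i (bar t i)) a b)"
      by (simp add: mmul_def sum_distrib_left mult_ac)
    then show ?thesis by (simp only: mmul_diag_mat_unit_mat low_facts[OF assms(1)] mult.assoc)
  qed
  have 2: "mmul t (\<lambda>a b. e * unit_mat i (bar t i) a b) (diag_mat t f) = (\<lambda>a b. e * f (bar t i) *
      unit_mat i (bar t i) a b)" for f
  proof -
    have "mmul t (\<lambda>a b. e * unit_mat i (bar t i) a b) (diag_mat t f) = (\<lambda>a b. e * mmul t (unit_mat
        i (bar t i)) (diag_mat t f) a b)"
      by (simp add: mmul_def sum_distrib_left mult_ac)
    then show ?thesis by (simp only: mmul_unit_mat_diag_mat low_facts[OF assms(1)] mult.assoc)
  qed
  show ?thesis
    unfolding even_state_def sbracket_even_elt_odd_elt inv 1 2 e_def[symmetric] Let_def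
    by (simp only: mmul_unit_mat_diag_mat mmul_diag_mat_unit_mat low_facts[OF assms(1)])
      (intro arg_cong2[of _ _ _ _ Pair] arg_cong2[of _ _ _ _ "odd_elt t"] ext refl; simp add:
          algebra_simps)
qed

text \<open>Both summands of the action on an odd block pick out the same diagonal entry, which
  gives the factor 2.\<close>

lemma odd_state_diag:
  assumes "i < t div 2"
  shows "sbracket (2*t) (odd_state kd t i) (even_elt kd t (diag_mat t f), False) =
     scale_state (case kd of Orth \<Rightarrow> - 2 * f i | Symp \<Rightarrow> 2 * f (bar t i)) (odd_state kd t i)"
proof (cases kd)
  case Orth
  have "(\<lambda>a b. - (f i * unit_mat i (bar t i) a b) - f i * unit_mat i (bar t i) a b)
      = (\<lambda>a b. (- 2 * f i) * unit_mat i (bar t i) a b)"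
    by (simp add: algebra_simps)
  then show ?thesis using Orth
    by (simp only: odd_state_def scale_state_def sbracket_odd_elt_even_elt inv_kind.case
        invol_diag_mat mmul_unit_mat_diag_mat mmul_diag_mat_unit_mat low_facts[OF assms]
      mmul_zero fst_conv snd_conv odd_elt_scale add_0_left)
next
  case Symp
  have "(\<lambda>a b. f (bar t i) * unit_mat i (bar t i) a b + f (bar t i) * unit_mat i (bar t i) a b)
      = (\<lambda>a b. (2 * f (bar t i)) * unit_mat i (bar t i) a b)"
    by (simp add: algebra_simps)
  then show ?thesis using Symp
    by (simp only: odd_state_def scale_state_def sbracket_odd_elt_even_elt inv_kind.case
        invol_diag_mat mmul_unit_mat_diag_mat mmul_diag_mat_unit_mat low_facts[OF assms]
      mmul_zero fst_conv snd_conv odd_elt_scale minus_zero diff_0_right)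
qed

text \<open>The symmetries of \<open>f\<close> and \<open>g\<close> make the lower block of the
  product minus the involution of the upper one, so the bracket returns to the even state.\<close>

lemma odd_state_odd_elt:
  assumes "i < t div 2" "inv_ok kd t"
    and sym: "f (bar t i) = f i" "g (bar t i) = - g i"
  shows "sbracket (2*t) (odd_state kd t i) (odd_elt t (diag_mat t f) (diag_mat t g), True) =
     scale_state (case kd of Orth \<Rightarrow> - g i | Symp \<Rightarrow> f i) (even_state kd t i)"
proof -
  have inv: "invol kd t (unit_mat i (bar t i)) = (\<lambda>a b. (case kd of Orth \<Rightarrow> 1 | Symp \<Rightarrow> -1) *
      unit_mat i (bar t i) a b)"
    using assms by (intro invol_unit_mat_bar) (auto simp: inv_ok_def)
  show ?thesis
  proof (cases kd)
    case Orth
    show ?thesis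
      unfolding odd_state_def even_state_def Orth inv_kind.case sbracket_odd_elt_odd_elt
          even_elt_def scale_state_blk inv[unfolded Orth inv_kind.case]
      by (simp only: mmul_unit_mat_diag_mat mmul_diag_mat_unit_mat low_facts[OF assms(1)] sym
          mmul_zero) (auto intro!: blk_eqI)
  next
    case Symp
    show ?thesis
      unfolding odd_state_def even_state_def Symp inv_kind.case sbracket_odd_elt_odd_elt
          even_elt_def scale_state_blk inv[unfolded Symp inv_kind.case]
      by (simp only: mmul_unit_mat_diag_mat mmul_diag_mat_unit_mat low_facts[OF assms(1)] sym
          mmul_zero) (auto intro!: blk_eqI)
  qed
qed

section \<open>Free letters and their action\<close>

text \<open>For each parity there are as many free letters as flat positions; this is why the lower
  and the upper bound grow at the same rate.\<close>

definition frees :: "nat \<Rightarrow> bool \<Rightarrow> spec set" where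
  "frees t b = (if b then OA ` {..<t div 2} \<union> OB ` {..<t div 2}
     else HP ` {..<t div 2} \<union> HQ ` {..<t div 2} \<union> (if odd t then {HM} else {}))"

lemma frees_parity: "u \<in> frees t b \<Longrightarrow> is_odd u = b"
  by (auto simp: frees_def split: if_splits)

lemma coeff_low:
  assumes "i < t div 2" "j < t div 2"
  shows "yf t j i = (if i = j then 1 else 0)" "zf t j i = (if i = j then 1 else 0)"
    "yf t j (bar t i) = (if i = j then 1 else 0)" "zf t j (bar t i) = (if i = j then -1 else 0)"
    "mf t i = 0" "odd t \<Longrightarrow> mf t (bar t i) = 0"
    "pf kd t j i = (if i = j \<and> kd = Symp then 1 else 0)"
    "pf kd t j (bar t i) = (if i = j \<and> kd = Orth then 1 else 0)"
  using assms by (auto simp: yf_def zf_def mf_def pf_def bar_def elim!: oddE split: inv_kind.splits)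

lemma sbracket_even_state_HP:
  assumes "i < t div 2" "j < t div 2"
  shows "sbracket (2*t) (even_state kd t i) (letter kd t (HP j)) =
    scale_state (if i = j then (case kd of Orth \<Rightarrow> 1 | Symp \<Rightarrow> -1) else 0) (even_state kd t i)"
  using assms by (simp add: letter_def even_state_diag coeff_low split: inv_kind.split)

lemma sbracket_even_state_HQ:
  assumes "i < t div 2" "j < t div 2"
  shows "sbracket (2*t) (even_state kd t i) (letter kd t (HQ j)) = scale_state 0 (even_state kd t i)"
  using assms by (simp add: letter_def even_state_diag coeff_low)

lemma sbracket_even_state_HM:
  assumes "i < t div 2" "odd t"
  shows "sbracket (2*t) (even_state kd t i) (letter kd t HM) = scale_state 0 (even_state kd t i)"
  using assms by (simp add: letter_def even_state_diag coeff_low(5,6)[OF assms(1) assms(1)])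

lemma sbracket_odd_state_HP:
  assumes "i < t div 2" "j < t div 2"
  shows "sbracket (2*t) (odd_state kd t i) (letter kd t (HP j)) = scale_state 0 (odd_state kd t i)"
  using assms by (simp add: letter_def odd_state_diag coeff_low split: inv_kind.split)

lemma sbracket_odd_state_HQ:
  assumes "i < t div 2" "j < t div 2"
  shows "sbracket (2*t) (odd_state kd t i) (letter kd t (HQ j)) =
     scale_state (if i = j then (case kd of Orth \<Rightarrow> -2 | Symp \<Rightarrow> 2) else 0) (odd_state kd t i)"
  using assms by (simp add: letter_def odd_state_diag coeff_low split: inv_kind.split)

lemma sbracket_odd_state_HM:
  assumes "i < t div 2" "odd t"
  shows "sbracket (2*t) (odd_state kd t i) (letter kd t HM) = scale_state 0 (odd_state kd t i)"
  using assms by (simp add: letter_def odd_state_diag coeff_low(5,6)[OF assms(1) assms(1)] split: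
      inv_kind.split)

lemma sbracket_even_state_OA:
  assumes "i < t div 2" "j < t div 2" "inv_ok kd t"
  shows "sbracket (2*t) (even_state kd t i) (letter kd t (OA j)) =
     scale_state (if i = j then (case kd of Orth \<Rightarrow> 2 | Symp \<Rightarrow> -2) else 0) (odd_state kd t i)"
  using assms
  by (cases kd) (simp_all add: letter_def even_state_odd_elt coeff_low odd_state_def
      scale_state_def odd_elt_scale)

lemma sbracket_even_state_OB:
  assumes "i < t div 2" "j < t div 2" "inv_ok kd t"
  shows "sbracket (2*t) (even_state kd t i) (letter kd t (OB j)) = scale_state 0 (odd_state kd t i)"
  using assms
  by (cases kd) (simp_all add: letter_def even_state_odd_elt coeff_low odd_state_def
      scale_state_def odd_elt_zero)

lemma sbracket_odd_state_OA:
  assumes "i < t div 2" "j < t div 2" "inv_ok kd t"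
  shows "sbracket (2*t) (odd_state kd t i) (letter kd t (OA j)) = scale_state 0 (even_state kd t i)"
  using assms
  by (cases kd) (simp_all add: letter_def odd_state_odd_elt coeff_low)

lemma sbracket_odd_state_OB:
  assumes "i < t div 2" "j < t div 2" "inv_ok kd t"
  shows "sbracket (2*t) (odd_state kd t i) (letter kd t (OB j)) =
    scale_state (if i = j then (case kd of Orth \<Rightarrow> -1 | Symp \<Rightarrow> 1) else 0) (even_state kd t i)"
  using assms
  by (cases kd) (simp_all add: letter_def odd_state_odd_elt coeff_low)

section \<open>Programs of letters\<close>

text \<open>Bracketing \<open>S\<close> successively with the letters of \<open>ws\<close> leads to
  a nonzero multiple of \<open>S'\<close>. In addition, at each \<open>Free\<close> letter all other
  free letters of that parity annihilate the current state.\<close>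

inductive prog :: "inv_kind \<Rightarrow> nat \<Rightarrow> 'a::field mat_fn \<times> bool \<Rightarrow> ltr list \<Rightarrow> 'a mat_fn \<times> bool \<Rightarrow> bool"
  for kd t where
  prog_Nil: "prog kd t S [] S"
| prog_Con: "sbracket (2*t) S (letter kd t u) = scale_state c S1 \<Longrightarrow> c \<noteq> 0 \<Longrightarrow> prog kd t S1 ws S' \<Longrightarrow>
    prog kd t S (Con u # ws) S'"
| prog_Free: "sbracket (2*t) S (letter kd t u) = scale_state c S1 \<Longrightarrow> c \<noteq> 0 \<Longrightarrow>
    (\<And>u'. u' \<in> frees t (is_odd u) \<Longrightarrow> u' \<noteq> u \<Longrightarrow> fst (sbracket (2*t) S (letter kd t u')) = zmat) \<Longrightarrow>
    prog kd t S1 ws S' \<Longrightarrow> prog kd t S (Free u # ws) S'"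

lemma prog_append:
  "prog kd t S ws S1 \<Longrightarrow> prog kd t S1 ws' S' \<Longrightarrow> prog kd t S (ws @ ws') S'"
  by (induction rule: prog.induct) (auto intro: prog.intros)

lemma prog_Con1: "sbracket (2*t) S (letter kd t u) = scale_state c S1 \<Longrightarrow> c \<noteq> 0 \<Longrightarrow> prog kd t S [Con u] S1"
  by (auto intro: prog.intros)

lemma prog_replicate: "prog kd t S ws S \<Longrightarrow> prog kd t S (concat (replicate q ws)) S"
  by (induction q) (auto intro: prog.intros prog_append)

text \<open>Describes which letter another substitution may put in the place of
  \<open>w\<close>.\<close>

definition compat :: "nat \<Rightarrow> ltr \<Rightarrow> ltr \<Rightarrow> bool" where
  "compat t w w' \<longleftrightarrow> (case w of Con u \<Rightarrow> w' = w
     | Free u \<Rightarrow> \<exists>u'. w' = Free u' \<and> u' \<in> frees t (is_odd u))"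

lemma compat_simps:
  "compat t (Con u) w' \<longleftrightarrow> w' = Con u"
  "compat t (Free u) w' \<longleftrightarrow> (\<exists>u'. w' = Free u' \<and> u' \<in> frees t (is_odd u))"
  by (simp_all add: compat_def)

definition run :: "inv_kind \<Rightarrow> nat \<Rightarrow> 'a::field mat_fn \<times> bool \<Rightarrow> ltr list \<Rightarrow> 'a mat_fn \<times> bool" where
  "run kd t S ws = foldl (sbracket (2*t)) S (map (\<lambda>w. letter kd t (core w)) ws)"

lemma run_simps [simp]:
  "run kd t S [] = S" "run kd t S (w # ws) = run kd t (sbracket (2*t) S (letter kd t (core w))) ws"
  by (simp_all add: run_def)

lemma run_scale_state: "run kd t (scale_state c S) ws = scale_state c (run kd t S ws)"
  by (induction ws arbitrary: S) (simp_all add: sbracket_scale_state)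

lemma scale_state_zero: "fst (scale_state 0 S) = zmat"
  by (simp add: scale_state_def)

lemma prog_run: "prog kd t S ws S' \<Longrightarrow> \<exists>c. c \<noteq> 0 \<and> run kd t S ws = scale_state c S'"
proof (induction rule: prog.induct)
  case (prog_Nil S)
  have "S = scale_state 1 S" by (simp add: scale_state_def)
  then show ?case by (metis run_simps(1) zero_neq_one)
qed (auto simp: run_scale_state scale_state_scale_state, (metis mult_eq_0_iff)+)

text \<open>Compatible words first differ at a \<open>Free\<close> letter, where the wrong letter
  annihilates the state; zero then persists under all further brackets.\<close>

lemma prog_run_zero:
  "prog kd t S ws S' \<Longrightarrow> list_all2 (compat t) ws ws' \<Longrightarrow> ws' \<noteq> ws \<Longrightarrow> fst (run kd t S ws') = zmat"
proof (induction arbitrary: ws' rule: prog.induct)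
  case (prog_Nil S)
  then show ?case by simp
next
  case (prog_Con S u c S1 ws S')
  then obtain vs where vs: "ws' = Con u # vs" "list_all2 (compat t) ws vs" "vs \<noteq> ws"
    by (auto simp: list_all2_Cons1 compat_simps)
  then have "fst (run kd t S1 vs) = zmat" using prog_Con by blast
  then show ?case using vs prog_Con(1) by (simp add: run_scale_state) (simp add: scale_state_def)
next
  case (prog_Free S u c S1 ws S')
  then obtain u' vs where vs: "ws' = Free u' # vs" "u' \<in> frees t (is_odd u)" "list_all2 (compat t)
      ws vs"
    by (auto simp: list_all2_Cons1 compat_simps)
  show ?case
  proof (cases "u' = u")
    case True
    then have "vs \<noteq> ws" using vs prog_Free.prems by auto
    then have "fst (run kd t S1 vs) = zmat" using prog_Free vs by blast
    then show ?thesis using vs prog_Free(1) True by (simp add: run_scale_state) (simp add: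
        scale_state_def)
  next
    case False
    define S2 where "S2 = sbracket (2*t) S (letter kd t u')"
    have "fst S2 = zmat" unfolding S2_def using prog_Free.hyps(3) vs False by blast
    \<comment> \<open>A zero state is 0 times itself, so homogeneity of \<open>run\<close> carries
      the zero to the end.\<close>
    then have "S2 = scale_state 0 S2" by (simp add: scale_state_def prod_eq_iff)
    then have "run kd t S2 vs = scale_state 0 (run kd t S2 vs)" by (metis run_scale_state)
    then have "fst (run kd t S2 vs) = zmat" by (metis scale_state_zero)
    then show ?thesis using vs by (simp add: S2_def)
  qed
qed

lemma prog_even_state_HP:
  assumes "i < t div 2" shows "prog kd t (even_state kd t i :: 'a::field_char_0 mat_fn \<times> bool)
      [Free (HP i)] (even_state kd t i)"
proof (rule prog_Free)
  show "sbracket (2*t) (even_state kd t i :: 'a mat_fn \<times> bool) (letter kd t (HP i)) = scale_state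
      (case kd of Orth \<Rightarrow> 1 | Symp \<Rightarrow> -1) (even_state kd t i)"
    using sbracket_even_state_HP[OF assms assms] by simp
  fix u assume "u \<in> frees t (is_odd (HP i))" "u \<noteq> HP i"
  then show "fst (sbracket (2*t) (even_state kd t i :: 'a mat_fn \<times> bool) (letter kd t u)) = zmat"
    using assms by (auto simp: frees_def sbracket_even_state_HP sbracket_even_state_HQ
        sbracket_even_state_HM scale_state_zero split: if_splits)
qed (auto intro: prog_Nil split: inv_kind.split)

lemma prog_odd_state_HQ:
  assumes "i < t div 2" shows "prog kd t (odd_state kd t i :: 'a::field_char_0 mat_fn \<times> bool)
      [Free (HQ i)] (odd_state kd t i)"
proof (rule prog_Free)
  show "sbracket (2*t) (odd_state kd t i :: 'a mat_fn \<times> bool) (letter kd t (HQ i)) = scale_state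
      (case kd of Orth \<Rightarrow> -2 | Symp \<Rightarrow> 2) (odd_state kd t i)"
    using sbracket_odd_state_HQ[OF assms assms] by simp
  fix u assume "u \<in> frees t (is_odd (HQ i))" "u \<noteq> HQ i"
  then show "fst (sbracket (2*t) (odd_state kd t i :: 'a mat_fn \<times> bool) (letter kd t u)) = zmat"
    using assms by (auto simp: frees_def sbracket_odd_state_HP sbracket_odd_state_HQ
        sbracket_odd_state_HM scale_state_zero split: if_splits)
qed (auto intro: prog_Nil split: inv_kind.split)

text \<open>Both forms are needed: \<open>seg\<close> passes between the two states once with
  \<open>Con\<close> letters and \<open>q\<close> times with counted \<open>Free\<close>
  letters.\<close>

lemma prog_even_state_OA:
  assumes "i < t div 2" "inv_ok kd t" "prog kd t (odd_state kd t i) ws S'"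
  shows "prog kd t (even_state kd t i :: 'a::field_char_0 mat_fn \<times> bool) (Free (OA i) # ws) S'"
    "prog kd t (even_state kd t i :: 'a::field_char_0 mat_fn \<times> bool) (Con (OA i) # ws) S'"
proof -
  let ?c = "(case kd of Orth \<Rightarrow> 2 | Symp \<Rightarrow> -2) :: 'a"
  have *: "sbracket (2*t) (even_state kd t i :: 'a mat_fn \<times> bool) (letter kd t (OA i)) =
      scale_state ?c (odd_state kd t i)"
    using sbracket_even_state_OA[OF assms(1,1,2)] by simp
  moreover have "?c \<noteq> 0" by (auto split: inv_kind.split)
  ultimately show "prog kd t (even_state kd t i) (Con (OA i) # ws) S'" using assms by (intro prog_Con)
  have "fst (sbracket (2*t) (even_state kd t i :: 'a mat_fn \<times> bool) (letter kd t u)) = zmat"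
    if "u \<in> frees t (is_odd (OA i))" "u \<noteq> OA i" for u
    using that assms by (auto simp: frees_def sbracket_even_state_OA sbracket_even_state_OB
        scale_state_zero)
  with * \<open>?c \<noteq> 0\<close> show "prog kd t (even_state kd t i) (Free (OA i) # ws) S'"
    using assms by (intro prog_Free)
qed

lemma prog_odd_state_OB:
  assumes "i < t div 2" "inv_ok kd t" "prog kd t (even_state kd t i) ws S'"
  shows "prog kd t (odd_state kd t i :: 'a::field_char_0 mat_fn \<times> bool) (Free (OB i) # ws) S'"
    "prog kd t (odd_state kd t i :: 'a::field_char_0 mat_fn \<times> bool) (Con (OB i) # ws) S'"
proof -
  let ?c = "(case kd of Orth \<Rightarrow> -1 | Symp \<Rightarrow> 1) :: 'a"
  have *: "sbracket (2*t) (odd_state kd t i :: 'a mat_fn \<times> bool) (letter kd t (OB i)) =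
      scale_state ?c (even_state kd t i)"
    using sbracket_odd_state_OB[OF assms(1,1,2)] by simp
  moreover have "?c \<noteq> 0" by (auto split: inv_kind.split)
  ultimately show "prog kd t (odd_state kd t i) (Con (OB i) # ws) S'" using assms by (intro prog_Con)
  have "fst (sbracket (2*t) (odd_state kd t i :: 'a mat_fn \<times> bool) (letter kd t u)) = zmat"
    if "u \<in> frees t (is_odd (OB i))" "u \<noteq> OB i" for u
    using that assms by (auto simp: frees_def sbracket_odd_state_OA sbracket_odd_state_OB
        scale_state_zero)
  with * \<open>?c \<noteq> 0\<close> show "prog kd t (odd_state kd t i) (Free (OB i) # ws) S'"
    using assms by (intro prog_Free)
qed

section \<open>The balanced word\<close>

text \<open>Each of the four free letters of the pair \<open>i\<close> occurs exactly
  \<open>q\<close> times: \<open>HP\<close> at the even state, \<open>HQ\<close> at the odd one,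
  \<open>OA\<close> and \<open>OB\<close> in alternation. The segment ends at the even state where
  it begins.\<close>

definition seg :: "nat \<Rightarrow> nat \<Rightarrow> ltr list" where
  "seg q i = concat (replicate q [Free (HP i)]) @ [Con (OA i)] @ concat (replicate q [Free (HQ
      i)]) @ [Con (OB i)]
     @ concat (replicate q [Free (OA i), Free (OB i)])"

text \<open>The pairs are visited from the inside outwards, because upper triangular matrix units
  can only widen the interval from \<open>i\<close> to \<open>bar i\<close>.\<close>

primrec segs :: "nat \<Rightarrow> nat \<Rightarrow> nat \<Rightarrow> ltr list" where
  "segs t q 0 = seg q 0"
| "segs t q (Suc i) = seg q (Suc i) @ [Con (XE (bar t (Suc i)) (bar t i)), Con (XE i (Suc i))] @
    segs t q i"

text \<open>The first letter serves as the initial state. For even \<open>t\<close> it is the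
  innermost even state. For odd \<open>t\<close> the middle odd element first absorbs the letters
  \<open>HM\<close>, two matrix units turn it into the innermost odd state, and \<open>OB\<close>
  leads to the even one.\<close>

definition start :: "nat \<Rightarrow> nat \<Rightarrow> ltr list" where
  "start t q = (if even t then [Con (XE (t div 2 - 1) (t div 2))]
     else [Con OM] @ concat (replicate q [Free HM]) @
       [Con (XE (t div 2 - 1) (t div 2)), Con (XE (t div 2 - 1) (t div 2)), Con (OB (t div 2 - 1))])"

text \<open>The \<open>r\<close> final letters only multiply the last state by a nonzero scalar;
  they adjust the length so that every large degree is reached.\<close>

definition word :: "nat \<Rightarrow> nat \<Rightarrow> nat \<Rightarrow> ltr list" where
  "word t q r = start t q @ segs t q (t div 2 - 1) @ concat (replicate r [Con (HP 0)])"

lemma prog_seg: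
  assumes "i < t div 2" "inv_ok kd t"
  shows "prog kd t (even_state kd t i :: 'a::field_char_0 mat_fn \<times> bool) (seg q i) (even_state kd t i)"
proof -
  have 1: "prog kd t (even_state kd t i :: 'a mat_fn \<times> bool) (concat (replicate q [Free (HP i)]))
      (even_state kd t i)"
    by (intro prog_replicate prog_even_state_HP assms)
  have 2: "prog kd t (odd_state kd t i :: 'a mat_fn \<times> bool) (concat (replicate q [Free (HQ i)]))
      (odd_state kd t i)"
    by (intro prog_replicate prog_odd_state_HQ assms)
  have 3: "prog kd t (even_state kd t i :: 'a mat_fn \<times> bool) (concat (replicate q [Free (OA i),
      Free (OB i)])) (even_state kd t i)"
    by (intro prog_replicate prog_even_state_OA prog_odd_state_OB prog_Nil assms)
  show ?thesis unfolding seg_def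
    by (intro prog_append[OF 1], unfold append_Cons append_Nil)
      (intro prog_even_state_OA prog_append[OF 2] prog_odd_state_OB 3 assms)
qed

text \<open>Two commutators of matrix units: the first moves the right index outwards, the second
  the left index, with the sign -1.\<close>

lemma prog_step_down:
  assumes "Suc i < t div 2" "prog kd t (even_state kd t i) ws S'"
  shows "prog kd t (even_state kd t (Suc i) :: 'a::field_char_0 mat_fn \<times> bool)
     (Con (XE (bar t (Suc i)) (bar t i)) # Con (XE i (Suc i)) # ws) S'"
proof (rule prog_Con[of _ _ _ _ 1 "(even_elt kd t (unit_mat (Suc i) (bar t i)), False)"])
  have b: "bar t (Suc i) < t" "bar t i < t" "bar t i \<noteq> Suc i" "bar t i \<noteq> i" "Suc i < t" "bar t
      (Suc i) \<noteq> Suc i"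
    using assms(1) by (auto simp: bar_def)
  show "sbracket (2*t) (even_state kd t (Suc i)) (letter kd t (XE (bar t (Suc i)) (bar t i)))
     = scale_state 1 (even_elt kd t (unit_mat (Suc i) (bar t i)), False)"
    using b by (simp add: even_state_def letter_def sbracket_even_elt_even_elt
        mmul_unit_mat_unit_mat scale_state_def)
  show "prog kd t (even_elt kd t (unit_mat (Suc i) (bar t i)), False) (Con (XE i (Suc i)) # ws) S'"
  proof (rule prog_Con)
    show "sbracket (2*t) (even_elt kd t (unit_mat (Suc i) (bar t i)), False) (letter kd t (XE i
        (Suc i))) = scale_state (-1) (even_state kd t i)"
      using b even_elt_scale[of kd t "-1" "unit_mat i (bar t i)"] by (simp add: even_state_def
          letter_def sbracket_even_elt_even_elt mmul_unit_mat_unit_mat scale_state_def)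
  qed (use assms in auto)
qed simp

lemma prog_segs:
  assumes "i < t div 2" "inv_ok kd t"
  shows "prog kd t (even_state kd t i :: 'a::field_char_0 mat_fn \<times> bool) (segs t q i) (even_state
      kd t 0)"
  using assms(1)
proof (induction i)
  case 0
  then show ?case using prog_seg assms(2) by simp
next
  case (Suc i)
  then show ?case using assms(2)
    by (simp only: segs.simps append_Cons append_Nil) (intro prog_append[OF prog_seg]
        prog_step_down; simp)
qed

lemma prog_start:
  assumes "t \<ge> 2" "inv_ok kd t"
  shows "\<exists>u ws. start t q = Con u # ws \<and>
     prog kd t (letter kd t u :: 'a::field_char_0 mat_fn \<times> bool) ws (even_state kd t (t div 2 - 1))"
proof (cases "even t")
  case True
  then have "bar t (t div 2 - 1) = t div 2" using assms(1) by (auto simp: bar_def)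
  then show ?thesis using True by (auto simp: start_def letter_def even_state_def intro!: prog_Nil)
next
  case False
  define m where "m = t div 2"
  have kd: "kd = Orth" using False assms(2) by (auto simp: inv_ok_def)
  have m: "t = 2 * m + 1" "m \<ge> 1" using False assms(1) by (auto simp: m_def elim!: oddE)
  let ?M = "letter kd t OM :: 'a mat_fn \<times> bool"
  \<comment> \<open>The middle index is fixed by the reflection, so both summands of the action see
    the single entry \<open>f m\<close>.\<close>
  have diag: "sbracket (2*t) ?M (even_elt kd t (diag_mat t f), False) = scale_state (- 2 * f m)
      ?M" for f :: "nat \<Rightarrow> 'a"
  proof -
    have "diag_mat t (\<lambda>a. mf t a * f (bar t a)) = (\<lambda>a b. f m * diag_mat t (mf t) a b)"
      "diag_mat t (\<lambda>a. f a * mf t a) = (\<lambda>a b. f m * diag_mat t (mf t) a b)"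
      using m by (auto simp: diag_mat_def mf_def fun_eq_iff bar_def)
    then have "sbracket (2*t) ?M (even_elt kd t (diag_mat t f), False)
        = (odd_elt t (\<lambda>a b. - (f m * diag_mat t (mf t) a b) - f m * diag_mat t (mf t) a b) zmat, True)"
      by (simp add: letter_def sbracket_odd_elt_even_elt invol_diag_mat mmul_diag_mat_diag_mat
          diag_mat_zero)
    also have "(\<lambda>a b. - (f m * diag_mat t (mf t) a b) - f m * diag_mat t (mf t) a b)
        = (\<lambda>a b. (- 2 * f m) * diag_mat t (mf t) a b)"
      by (simp add: algebra_simps)
    finally show ?thesis
      by (simp only: odd_elt_scale) (simp add: scale_state_def letter_def diag_mat_zero)
  qed
  have 1: "prog kd t ?M [Free HM] ?M"
  proof (rule prog_Free)
    show "sbracket (2*t) ?M (letter kd t HM) = scale_state (-2) ?M"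
      unfolding letter_def[of kd t HM] by (simp add: diag) (simp add: mf_def m_def)
    fix u assume "u \<in> frees t (is_odd HM)" "u \<noteq> HM"
    then obtain j where j: "j < m" "u = HP j \<or> u = HQ j" by (auto simp: frees_def m_def split:
        if_splits)
    have "j \<noteq> m" "bar t j \<noteq> m" using j m by (auto simp: bar_def)
    then have "pf kd t j m = (0 :: 'a)" "yf t j m = (0 :: 'a)"
      by (auto simp: kd pf_def yf_def)
    then obtain f :: "nat \<Rightarrow> 'a" where "letter kd t u = (even_elt kd t (diag_mat t f), False)" "f m = 0"
      using j(2) by (auto simp: letter_def)
    then have "sbracket (2*t) ?M (letter kd t u) = scale_state 0 ?M" by (simp add: diag)
    then show "fst (sbracket (2*t) ?M (letter kd t u)) = zmat" by (simp add: scale_state_zero)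
  qed (auto intro: prog_Nil)
  \<comment> \<open>The intermediate stage: the first matrix unit and its involution spread the
    middle entry to the two neighbouring superdiagonal positions, and the second bracket gathers
    both at \<open>(m - 1, m + 1)\<close>, whence the factor 2 in \<open>x2\<close>.\<close>
  define Y :: "'a mat_fn" where "Y = (\<lambda>a b. unit_mat (m - 1) m a b + unit_mat m (m + 1) a b)"
  have inv: "invol kd t (unit_mat (m - 1) m) = (unit_mat m (m + 1) :: 'a mat_fn)"
    using m by (simp add: invol_unit_mat kd) (simp add: bar_def)
  have x1: "sbracket (2*t) ?M (letter kd t (XE (m - 1) m)) = scale_state (-1) (odd_elt t Y zmat, True)"
  proof -
    have "mmul t (unit_mat (m - 1) m) (diag_mat t (mf t)) = (unit_mat (m - 1) m :: 'a mat_fn)"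
      "mmul t (diag_mat t (mf t)) (unit_mat m (m + 1)) = (unit_mat m (m + 1) :: 'a mat_fn)"
      using m by (auto simp: mmul_unit_mat_diag_mat mmul_diag_mat_unit_mat mf_def)
    then show ?thesis
      using odd_elt_scale(1)[of t "-1" Y]
      by (simp add: letter_def sbracket_odd_elt_even_elt diag_mat_zero inv[unfolded One_nat_def]
          scale_state_def Y_def)
  qed
  have bar: "bar t (m - 1) = m + 1" using m by (auto simp: bar_def)
  have x2: "sbracket (2*t) (odd_elt t Y zmat, True) (letter kd t (XE (m - 1) m)) = scale_state
      (-2) (odd_state kd t (m - 1))"
  proof -
    have "mmul t (unit_mat (m - 1) m) Y = (unit_mat (m - 1) (m + 1) :: 'a mat_fn)"
      "mmul t Y (unit_mat m (m + 1)) = (unit_mat (m - 1) (m + 1) :: 'a mat_fn)"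
      using m by (auto simp: mmul_unit_mat_left mmul_unit_mat_right fun_eq_iff) (auto simp: Y_def
          unit_mat_def)
    then show ?thesis
      using odd_elt_scale(1)[of t "-2 :: 'a" "unit_mat (m - 1) (m + 1)"] bar
      by (simp add: letter_def sbracket_odd_elt_even_elt inv[unfolded One_nat_def kd]
          scale_state_def odd_state_def kd)
  qed
  have x3: "prog kd t (odd_state kd t (m - 1) :: 'a mat_fn \<times> bool) [Con (OB (m - 1))] (even_state
      kd t (m - 1))"
    using m by (intro prog_odd_state_OB prog_Nil assms) (simp add: m_def)
  have "prog kd t ?M (concat (replicate q [Free HM]) @
       [Con (XE (m - 1) m), Con (XE (m - 1) m), Con (OB (m - 1))]) (even_state kd t (m - 1))"
    by (intro prog_append[OF prog_replicate[OF 1]] prog_Con[OF x1] prog_Con[OF x2] x3) simp_all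
  then show ?thesis using False by (auto simp: start_def m_def)
qed

lemma prog_word:
  assumes "t \<ge> 2" "inv_ok kd t"
  shows "\<exists>u ws. word t q r = Con u # ws \<and>
     prog kd t (letter kd t u :: 'a::field_char_0 mat_fn \<times> bool) ws (even_state kd t 0)"
proof -
  obtain u ws where u: "start t q = Con u # ws"
    "prog kd t (letter kd t u :: 'a mat_fn \<times> bool) ws (even_state kd t (t div 2 - 1))"
    using prog_start[OF assms] by blast
  have pos: "0 < t div 2" using assms(1) by simp
  have "prog kd t (even_state kd t 0 :: 'a mat_fn \<times> bool) [Con (HP 0)] (even_state kd t 0)"
    using sbracket_even_state_HP[OF pos pos, of kd] by (rule prog_Con1) (auto split: inv_kind.split)
  then have "prog kd t (letter kd t u :: 'a mat_fn \<times> bool)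
     (ws @ segs t q (t div 2 - 1) @ concat (replicate r [Con (HP 0)])) (even_state kd t 0)"
    using pos assms by (intro prog_append[OF u(2)] prog_append[OF prog_segs] prog_replicate) auto
  then show ?thesis using u(1) by (auto simp: word_def)
qed

section \<open>Counting independent monomials\<close>

lemma seval_foldl:
  "seval N k \<sigma> (foldl (\<lambda>m v. Mul m (Var v)) m0 vs) =
     foldl (sbracket N) (seval N k \<sigma> m0) (map (\<lambda>v. (\<sigma> v, \<not> v < k)) vs)"
  by (induction vs arbitrary: m0) (simp_all add: seval_Mul_sbracket del: seval.simps(2))

lemma leaves_foldl: "leaves (foldl (\<lambda>m v. Mul m (Var v)) m0 vs) = leaves m0 @ vs"
  by (induction vs arbitrary: m0) simp_all

text \<open>Evaluation at \<open>\<sigma> \<tau>\<close> followed by taking the entry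
  \<open>(a, b)\<close> gives functionals that are dual to the functions of the monomials
  \<open>f \<tau>\<close> up to nonzero scalars, so these functions are independent.\<close>

lemma ccodim_ge_card:
  fixes f :: "'b \<Rightarrow> nmon" and \<sigma> :: "'b \<Rightarrow> nat \<Rightarrow> 'a::field_char_0 mat_fn"
  assumes "\<And>\<tau>. \<tau> \<in> T \<Longrightarrow> f \<tau> \<in> multilin n"
    and "\<And>\<tau> \<tau>'. \<tau> \<in> T \<Longrightarrow> \<tau>' \<in> T \<Longrightarrow> mon_fun kd t k n (f \<tau>) (\<sigma> \<tau>') a b \<noteq> 0 \<longleftrightarrow> \<tau> = \<tau>'"
  shows "card T \<le> ccodim TYPE('a) kd t k n"
proof -
  let ?g = "\<lambda>\<tau>. mon_fun kd t k n (f \<tau>) :: (nat \<Rightarrow> 'a mat_fn) \<Rightarrow> _"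
  let ?V = "mon_fun kd t k n ` multilin n :: ((nat \<Rightarrow> 'a mat_fn) \<Rightarrow> 'a mat_fn) set"
  have inj: "inj_on ?g T"
    by (rule inj_onI) (metis assms(2))
  have indep: "fs.independent (?g ` T)"
    unfolding fs.dependent_def
  proof safe
    fix \<tau> assume \<tau>: "\<tau> \<in> T" "?g \<tau> \<in> fs.span (?g ` T - {?g \<tau>})"
    have "?g \<tau> (\<sigma> \<tau>) a b = 0"
      using \<tau>(2)
    proof (rule fs.span_induct)
      show "fs.subspace {g. g (\<sigma> \<tau>) a b = 0}"
        by (auto simp: fs.subspace_def fscale_def)
      show "g (\<sigma> \<tau>) a b = 0" if g: "g \<in> ?g ` T - {?g \<tau>}" for g
      proof -
        obtain \<tau>' where "\<tau>' \<in> T" "g = ?g \<tau>'" "g \<noteq> ?g \<tau>" using g by blast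
        then show ?thesis using assms(2)[of \<tau>' \<tau>] \<tau>(1) by metis
      qed
    qed
    then show False using assms(2)[OF \<tau>(1) \<tau>(1)] by simp
  qed
  obtain B where B: "B \<subseteq> ?V" "fs.independent B" "?V \<subseteq> fs.span B" "card B = fs.dim ?V"
    using fs.basis_exists[of ?V] by blast
  \<comment> \<open>The finite spanning set of the upper bound makes the basis \<open>B\<close>
    finite, as the comparison of cardinalities requires.\<close>
  have "?V \<subseteq> fs.span (spanning kd t k n)"
    by (intro image_subsetI mon_fun_in_span)
  with B(1) have "B \<subseteq> fs.span (spanning kd t k n)" by (rule order_trans)
  then have "finite B"
    using fs.independent_span_bound[OF finite_spanning B(2)] by simp
  moreover have "?g ` T \<subseteq> fs.span B" using B(3) assms(1) by auto
  ultimately have "card (?g ` T) \<le> card B"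
    using fs.independent_span_bound[of B "?g ` T"] indep by simp
  then show ?thesis using B(4) inj by (simp add: card_image ccodim_def)
qed

section \<open>Words as monomials and as substitutions\<close>

fun valid :: "nat \<Rightarrow> spec \<Rightarrow> bool" where
  "valid t (OA j) \<longleftrightarrow> j < t div 2" | "valid t (OB j) \<longleftrightarrow> j < t div 2"
| "valid t OM \<longleftrightarrow> odd t" | "valid t (XE i j) \<longleftrightarrow> i \<le> j \<and> j < t"
| "valid t _ \<longleftrightarrow> True"

lemma diag_mat_UT: "diag_mat t f \<in> UT t"
  by (auto simp: diag_mat_def UT_def)

lemma even_elt_S_even: "x \<in> UT t \<Longrightarrow> even_elt kd t x \<in> S_even kd t"
  by (auto simp: S_even_def even_elt_def)

lemma odd_elt_S_odd:
  assumes "\<And>a. a < t \<Longrightarrow> f (bar t a) = f a" "\<And>a. a < t \<Longrightarrow> g (bar t a) = - g a"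
  shows "odd_elt t (diag_mat t f) (diag_mat t g) \<in> S_odd kd t"
proof -
  have "diag_mat t f \<in> Rplus kd t" using assms(1)
    by (auto simp: Rplus_def diag_mat_UT invol_diag_mat) (auto simp: diag_mat_def fun_eq_iff)
  moreover have "diag_mat t g \<in> Rminus kd t" using assms(2)
    by (auto simp: Rminus_def diag_mat_UT invol_diag_mat) (auto simp: diag_mat_def fun_eq_iff)
  ultimately show ?thesis unfolding S_odd_def odd_elt_def by blast
qed

lemma zf_bar: "j < t div 2 \<Longrightarrow> a < t \<Longrightarrow> zf t j (bar t a) = - zf t j a"
  unfolding zf_def bar_def by auto

lemma mf_bar: "odd t \<Longrightarrow> a < t \<Longrightarrow> mf t (bar t a) = mf t a"
  unfolding mf_def bar_def by (auto elim!: oddE)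

lemma letter_val_S_part:
  assumes "valid t u"
  shows "(letter_val kd t u :: 'a::field mat_fn) \<in> S_part kd t (is_odd u)"
proof (cases u)
  case (XE i j)
  have "(unit_mat i j :: 'a mat_fn) \<in> UT t" using assms XE by (auto simp: UT_def unit_mat_def)
  then show ?thesis using XE by (simp add: S_part_def even_elt_S_even)
next
  case (OA j)
  then show ?thesis using assms
    by (auto simp: S_part_def yf_bar zf_bar intro!: odd_elt_S_odd split: inv_kind.split)
next
  case (OB j)
  then show ?thesis using assms
    by (auto simp: S_part_def yf_bar zf_bar intro!: odd_elt_S_odd split: inv_kind.split)
next
  case OM
  then show ?thesis using assms by (auto simp: S_part_def mf_bar intro!: odd_elt_S_odd)
qed (auto simp: S_part_def intro!: even_elt_S_even diag_mat_UT)

text \<open>A word \<open>\<tau>\<close> acts as a substitution giving the letter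
  \<open>\<tau> ! v\<close> to the variable \<open>v\<close>. Its monomial is left-normed and takes
  the variables in the order in which their letters spell \<open>W\<close>. Under the substitution
  of another word it spells a compatible word, and the value is nonzero only if this is again
  \<open>W\<close>, that is, if the two words agree.\<close>

lemma ccodim_ge_words:
  assumes W: "W = Con u0 # ws" "prog kd t (letter kd t u0 :: 'a::field_char_0 mat_fn \<times> bool) ws
      (even_state kd t 0)"
    and t: "t \<ge> 2"
    and T: "\<And>\<tau>. \<tau> \<in> T \<Longrightarrow> mset \<tau> = mset W"
    and valid: "\<And>w. w \<in> set W \<Longrightarrow> valid t (core w)"
    and par: "\<And>\<tau>. \<tau> \<in> T \<Longrightarrow> map (\<lambda>w. is_odd (core w)) \<tau> = replicate k False @ replicate l True"
    and compat: "\<And>\<tau> \<tau>'. \<tau> \<in> T \<Longrightarrow> \<tau>' \<in> T \<Longrightarrow> list_all2 (compat t) \<tau> \<tau>'"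
  shows "card T \<le> ccodim TYPE('a) kd t k (k + l)"
proof (cases "T = {}")
  case False
  define n where "n = length W"
  have len: "length \<tau> = n" if "\<tau> \<in> T" for \<tau>
    using T[OF that] unfolding n_def by (metis size_mset)
  have n: "n = k + l" using False par len by (metis ex_in_conv length_append length_map
      length_replicate)
  have parity: "is_odd (core (\<tau> ! v)) \<longleftrightarrow> \<not> v < k" if "\<tau> \<in> T" "v < n" for \<tau> v
  proof -
    have "is_odd (core (\<tau> ! v)) = map (\<lambda>w. is_odd (core w)) \<tau> ! v" using that len by simp
    then show ?thesis using that n by (simp add: par nth_append)
  qed
  have "\<exists>p. p permutes {..<n} \<and> permute_list p \<tau> = W" if "\<tau> \<in> T" for \<tau>
    using mset_eq_permutation[of W \<tau>] T[OF that] len[OF that] by auto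
  then obtain p where p: "\<And>\<tau>. \<tau> \<in> T \<Longrightarrow> p \<tau> permutes {..<n}" "\<And>\<tau>. \<tau> \<in> T \<Longrightarrow> permute_list (p \<tau>) \<tau> = W"
    by metis
  define f where "f \<tau> = foldl (\<lambda>m v. Mul m (Var v)) (Var (p \<tau> 0)) (map (p \<tau>) [1..<n])" for \<tau>
  define \<sigma> :: "ltr list \<Rightarrow> nat \<Rightarrow> 'a mat_fn"
    where "\<sigma> \<tau> v = letter_val kd t (core (\<tau> ! v))" for \<tau> v
  have npos: "n > 0" by (simp add: n_def W(1))
  have upt: "[0..<n] = 0 # [1..<n]" using npos by (simp add: upt_conv_Cons)
  have leaves_f: "leaves (f \<tau>) = map (p \<tau>) [0..<n]" for \<tau>
    unfolding f_def leaves_foldl by (simp add: upt)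
  show ?thesis unfolding n[symmetric]
  proof (rule ccodim_ge_card[where f = f and \<sigma> = \<sigma> and a = 0 and b = "bar t 0"])
    fix \<tau> assume \<tau>: "\<tau> \<in> T"
    have "distinct (map (p \<tau>) [0..<n])"
      using p(1)[OF \<tau>] by (auto simp: distinct_map intro: permutes_inj_on)
    moreover have "set (map (p \<tau>) [0..<n]) = {..<n}"
      using permutes_image[OF p(1)[OF \<tau>]] by (simp add: lessThan_atLeast0)
    ultimately show "f \<tau> \<in> multilin n" by (simp add: multilin_def leaves_f)
  next
    fix \<tau> \<tau>' assume \<tau>: "\<tau> \<in> T" and \<tau>': "\<tau>' \<in> T"
    have lt: "p \<tau> i < n" if "i < n" for i
      using permutes_in_image[OF p(1)[OF \<tau>]] that by auto
    have gr: "gr_subst kd t k n (\<sigma> \<tau>')"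
    proof -
      have *: "\<sigma> \<tau>' v \<in> S_part kd t (\<not> v < k)" if "v < n" for v
      proof -
        have "\<tau>' ! v \<in> set W" using that len[OF \<tau>'] T[OF \<tau>'] by (metis nth_mem set_mset_mset)
        then have "(letter_val kd t (core (\<tau>' ! v)) :: 'a mat_fn) \<in> S_part kd t (is_odd (core (\<tau>'
            ! v)))"
          by (intro letter_val_S_part valid)
        then show ?thesis using parity[OF \<tau>' that] by (simp add: \<sigma>_def)
      qed
      show ?thesis
        unfolding gr_subst_def
      proof (intro conjI allI impI)
        show "\<sigma> \<tau>' i \<in> S_even kd t" if "i < k" for i
          using *[of i] that n by (simp add: S_part_def)
        show "\<sigma> \<tau>' i \<in> S_odd kd t" if "k \<le> i \<and> i < n" for i
          using *[of i] that by (simp add: S_part_def)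
      qed
    qed
    \<comment> \<open>The word spelled by the monomial of \<open>\<tau>\<close> under the
      substitution of \<open>\<tau>'\<close>.\<close>
    define V where "V = permute_list (p \<tau>) \<tau>'"
    have V: "V = map (\<lambda>i. \<tau>' ! p \<tau> i) [0..<n]" by (simp add: V_def permute_list_def len[OF \<tau>'])
    have W': "W = map (\<lambda>i. \<tau> ! p \<tau> i) [0..<n]"
      using p(2)[OF \<tau>] by (simp add: permute_list_def len[OF \<tau>])
    have "list_all2 (compat t) W V"
      using compat[OF \<tau> \<tau>'] lt unfolding V W' by (auto simp: list_all2_conv_all_nth len[OF \<tau>])
    \<comment> \<open>The first letter of \<open>W\<close> is constant, so every such evaluation
      starts in the same state.\<close>
    then obtain vs where vs: "V = Con u0 # vs" "list_all2 (compat t) ws vs"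
      unfolding W(1) by (auto simp: list_all2_Cons1 compat_simps)
    have let_eq: "(\<sigma> \<tau>' v, \<not> v < k) = letter kd t (core (\<tau>' ! v))" if "v < n" for v
      using parity[OF \<tau>' that] by (simp add: \<sigma>_def letter_def)
    have "seval (2*t) k (\<sigma> \<tau>') (f \<tau>) = run kd t (letter kd t u0) vs"
    proof -
      have V2: "\<tau>' ! p \<tau> 0 = Con u0" "vs = map (\<lambda>i. \<tau>' ! p \<tau> i) [1..<n]"
        using V vs(1) by (simp_all add: upt)
      have "seval (2*t) k (\<sigma> \<tau>') (f \<tau>) = foldl (sbracket (2*t)) (\<sigma> \<tau>' (p \<tau> 0), \<not> p \<tau> 0 < k)
          (map (\<lambda>v. (\<sigma> \<tau>' v, \<not> v < k)) (map (p \<tau>) [1..<n]))"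
        unfolding f_def seval_foldl by simp
      also have "map (\<lambda>v. (\<sigma> \<tau>' v, \<not> v < k)) (map (p \<tau>) [1..<n]) = map (\<lambda>w. letter kd t (core w)) vs"
        unfolding V2(2) using let_eq lt by simp
      also have "(\<sigma> \<tau>' (p \<tau> 0), \<not> p \<tau> 0 < k) = letter kd t u0"
        using let_eq[OF lt[OF npos]] V2(1) by simp
      finally show ?thesis by (simp add: run_def)
    qed
    then have val: "mon_fun kd t k n (f \<tau>) (\<sigma> \<tau>') = fst (run kd t (letter kd t u0) vs)"
      using gr by (simp add: mon_fun_def)
    have entry: "fst (even_state kd t 0 :: 'a mat_fn \<times> bool) 0 (bar t 0) = 1"
      using t by (auto simp: even_state_def even_elt_def blk_def unit_mat_def bar_def)
    show "mon_fun kd t k n (f \<tau>) (\<sigma> \<tau>') 0 (bar t 0) \<noteq> 0 \<longleftrightarrow> \<tau> = \<tau>'"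
    proof
      assume "\<tau> = \<tau>'"
      then have "V = W" using V W' by simp
      then have "vs = ws" using W(1) vs(1) by simp
      moreover obtain c where "c \<noteq> 0" "run kd t (letter kd t u0 :: 'a mat_fn \<times> bool) ws =
          scale_state c (even_state kd t 0)"
        using prog_run[OF W(2)] by blast
      ultimately show "mon_fun kd t k n (f \<tau>) (\<sigma> \<tau>') 0 (bar t 0) \<noteq> 0"
        unfolding val by (simp add: scale_state_def entry)
    next
      assume "mon_fun kd t k n (f \<tau>) (\<sigma> \<tau>') 0 (bar t 0) \<noteq> 0"
      then have nz: "fst (run kd t (letter kd t u0 :: 'a mat_fn \<times> bool) vs) 0 (bar t 0) \<noteq> 0"
        unfolding val .
      have "vs = ws"
      proof (rule ccontr)
        assume "vs \<noteq> ws"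
        from fun_cong[OF fun_cong[OF prog_run_zero[OF W(2) vs(2) this]]] nz show False by (rule
            notE[rotated])
      qed
      then have "V = W" using vs W by simp
      then have *: "\<tau>' ! p \<tau> i = \<tau> ! p \<tau> i" if "i < n" for i
        using that unfolding V W' by simp
      show "\<tau> = \<tau>'"
      proof (rule nth_equalityI)
        fix i assume "i < length \<tau>"
        then have "i \<in> p \<tau> ` {..<n}" using permutes_image[OF p(1)[OF \<tau>]] len[OF \<tau>] by simp
        then show "\<tau> ! i = \<tau>' ! i" using * by auto
      qed (simp add: len \<tau> \<tau>')
    qed
  qed
qed simp

section \<open>Letter counts of the balanced word\<close>

lemma count_concat_replicate: "count (mset (concat (replicate q ws))) x = q * count (mset ws) x"
  by (induction q) simp_all

lemma count_seg: "count (mset (seg q i)) (Free u) = (if u \<in> {HP i, HQ i, OA i, OB i} then q else 0)"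
  by (simp add: seg_def count_concat_replicate)

lemma count_segs:
  "count (mset (segs t q i)) (Free u) =
    (if (case u of HP j \<Rightarrow> j \<le> i | HQ j \<Rightarrow> j \<le> i | OA j \<Rightarrow> j \<le> i | OB j \<Rightarrow> j \<le> i | _ \<Rightarrow> False) then q
        else 0)"
  by (induction i; cases u) (simp_all add: count_seg le_Suc_eq)

lemma count_start: "count (mset (start t q)) (Free u) = (if odd t \<and> u = HM then q else 0)"
  by (simp add: start_def count_concat_replicate)

lemma count_word:
  assumes "t \<ge> 2"
  shows "count (mset (word t q r)) (Free u) = (if u \<in> frees t (is_odd u) then q else 0)"
proof -
  have "j \<le> t div 2 - 1 \<longleftrightarrow> j < t div 2" for j using assms by auto
  then show ?thesis
    by (cases u) (auto simp: word_def count_segs count_start count_concat_replicate frees_def)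
qed

abbreviation is_free :: "ltr \<Rightarrow> bool" where "is_free w \<equiv> (\<exists>u. w = Free u)"

lemma filter_concat_replicate: "filter P (concat (replicate q ws)) = concat (replicate q (filter P ws))"
  by (simp add: filter_concat)

lemma concat_replicate_Nil [simp]: "concat (replicate q []) = []"
  by (induction q) auto

text \<open>The parameter \<open>q\<close> affects only free letters and \<open>r\<close> only the
  padding, so the remaining constant letters contribute a fixed length.\<close>

lemma length_filter_word:
  assumes "\<And>u. \<not> P (Free u)"
  shows "length (filter P (word t q r)) = length (filter P (word t 0 0)) + (if P (Con (HP 0)) then
      r else 0)"
proof -
  have seg: "filter P (seg q i) = filter P (seg 0 i)" for i
    using assms by (simp add: seg_def filter_concat_replicate)
  have "filter P (segs t q i) = filter P (segs t 0 i)" for i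
    by (induction i) (simp_all add: seg)
  moreover have "filter P (start t q) = filter P (start t 0)"
    using assms by (simp add: start_def filter_concat_replicate)
  moreover have "length (concat (replicate r [Con (HP 0)])) = r" by (induction r) auto
  ultimately show ?thesis by (simp add: word_def filter_concat_replicate)
qed

lemma valid_word:
  assumes "t \<ge> 2" "w \<in> set (word t q r)"
  shows "valid t (core w)"
proof -
  have seg: "valid t (core w)" if "w \<in> set (seg q i)" "i < t div 2" for w i
    using that by (auto simp: seg_def split: if_splits)
  have segs: "i < t div 2 \<Longrightarrow> w \<in> set (segs t q i) \<Longrightarrow> valid t (core w)" for w i
  proof (induction i)
    case 0 then show ?case using seg by simp
  next
    case (Suc i)
    then show ?case using seg[of w "Suc i"] by (auto simp: bar_def)
  qed
  have "valid t (core w)" if "w \<in> set (start t q)" for w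
    using that assms(1) by (auto simp: start_def split: if_splits)
  then show ?thesis using assms segs[of "t div 2 - 1" w] by (auto simp: word_def)
qed

lemma card_frees: "card (frees t b) = (if b then 2 * (t div 2) else t)" and finite_frees: "finite
    (frees t b)"
proof -
  show "finite (frees t b)" by (simp add: frees_def)
  have 1: "card (OA ` {..<m} \<union> OB ` {..<m}) = 2 * m" for m
    by (subst card_Un_disjoint) (auto simp: card_image inj_on_def)
  have 2: "card (HP ` {..<m} \<union> HQ ` {..<m}) = 2 * m" for m
    by (subst card_Un_disjoint) (auto simp: card_image inj_on_def)
  have 3: "card (HP ` {..<m} \<union> HQ ` {..<m} \<union> {HM}) = 2 * m + 1" for m
    by (subst card_Un_disjoint) (auto simp: 2)
  show "card (frees t b) = (if b then 2 * (t div 2) else t)"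
    unfolding frees_def using 1 2 3 by (cases "even t") (auto elim!: evenE oddE)
qed

section \<open>Multinomial estimates\<close>

text \<open>The multinomial coefficient of equal multiplicities, written as a product to avoid
  division in the natural numbers.\<close>

lemma card_permutations_balanced:
  assumes "finite U" "\<And>u. count M u = (if u \<in> U then q else 0)"
  shows "size M = card U * q" "card (permutations_of_multiset M) * fact q ^ card U = fact (card U * q)"
proof -
  have sub: "set_mset M \<subseteq> U"
    using assms(2) by (metis count_eq_zero_iff subsetI)
  have "size M = (\<Sum>u\<in>U. count M u)"
    unfolding size_multiset_overloaded_eq using sub assms(1)
    by (intro sum.mono_neutral_left) (auto simp: not_in_iff)
  then show size: "size M = card U * q" using assms by simp
  have "(\<Prod>u\<in>set_mset M. fact (count M u)) = (\<Prod>u\<in>U. fact (count M u) :: nat)"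
    using sub assms(1) by (intro prod.mono_neutral_left) (auto simp: not_in_iff)
  also have "\<dots> = fact q ^ card U" using assms by simp
  finally have "(\<Prod>u\<in>set_mset M. fact (count M u)) = (fact q ^ card U :: nat)" .
  then show "card (permutations_of_multiset M) * fact q ^ card U = fact (card U * q)"
    using card_permutations_of_multiset_aux[of M] size by (simp add: mult.commute)
qed

text \<open>The balanced multinomial coefficient is the full power up to a polynomial factor. In the
  induction step the factor \<open>(N * Suc q) ^ N\<close> of the hypothesis is absorbed by the
  \<open>N\<close> new factors of the factorial, all larger than \<open>N * Suc q\<close>.\<close>

lemma balanced_factorial_bound:
  assumes "N \<ge> 1"
  shows "N ^ (N * Suc q) * fact (Suc q) ^ N \<le> (fact (N * Suc q) :: nat) * (N * Suc q) ^ N"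
proof (induction q)
  case 0
  then show ?case using assms by (simp add: fact_ge_1)
next
  case (Suc q)
  have fact_add: "fact n * n ^ j \<le> (fact (n + j) :: nat)" for n j
  proof (induction j)
    case (Suc j)
    have "fact n * n ^ Suc j = n * (fact n * n ^ j)" by simp
    also have "\<dots> \<le> Suc (n + j) * fact (n + j)"
      using Suc by (intro mult_mono) auto
    finally show ?case by simp
  qed simp
  have "N ^ (N * Suc (Suc q)) * fact (Suc (Suc q)) ^ N
      = (N * Suc (Suc q)) ^ N * (N ^ (N * Suc q) * fact (Suc q) ^ N)"
  proof -
    have "N ^ (N * Suc (Suc q)) = N ^ N * N ^ (N * Suc q)"
      by (simp add: power_add[symmetric])
    moreover have "(fact (Suc (Suc q)) :: nat) ^ N = Suc (Suc q) ^ N * fact (Suc q) ^ N"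
      by (simp only: fact_Suc[of "Suc q"] of_nat_id power_mult_distrib)
    ultimately show ?thesis
      by (simp only: power_mult_distrib[of N "Suc (Suc q)"] mult_ac)
  qed
  also have "\<dots> \<le> (N * Suc (Suc q)) ^ N * (fact (N * Suc q) * (N * Suc q) ^ N)"
    using Suc by (rule mult_left_mono) simp
  also have "\<dots> \<le> (N * Suc (Suc q)) ^ N * fact (N * Suc q + N)"
    by (intro mult_left_mono fact_add) simp
  also have "N * Suc q + N = N * Suc (Suc q)" by simp
  finally show ?case by (simp only: mult.commute)
qed

text \<open>Serves to discard the constant letters from the number of ways to select the even
  variables.\<close>

lemma binomial_mono2:
  assumes "a \<le> a'" "b \<le> b'"
  shows "(a + b) choose a \<le> (a' + b') choose a'"
proof -
  have "(a + b) choose a \<le> (a + b') choose a" using assms by (intro binomial_right_mono) simp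
  also have "\<dots> = (a + b') choose b'" using binomial_symmetric[of a "a + b'"] by simp
  also have "\<dots> \<le> (a' + b') choose b'" using assms by (intro binomial_right_mono) simp
  also have "\<dots> = (a' + b') choose a'" using binomial_symmetric[of a' "a' + b'"] by simp
  finally show ?thesis .
qed

section \<open>The lower bound for the codimensions\<close>

text \<open>One summand of the graded codimension suffices. The selection of the even variables and
  the arrangements of the even and of the odd free letters together give the multinomial coefficient
  \<open>(N q)! / q! ^ N\<close>.\<close>

lemma gr_codim_lower:
  assumes "t \<ge> 2" "inv_ok kd t"
  defines "N \<equiv> t + 2 * (t div 2)"
  shows "fact (N * q) \<le> gr_codim TYPE('a::field_char_0) kd t (N * q + (length (word t 0 0) + r)) *
      fact q ^ N"
proof -
  define W where "W = word t q r"
  define fe where "fe = (\<lambda>w. is_free w \<and> \<not> is_odd (core w))"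
  define fo where "fo = (\<lambda>w. is_free w \<and> is_odd (core w))"
  define ce where "ce = (\<lambda>w. \<not> is_free w \<and> \<not> is_odd (core w))"
  define co where "co = (\<lambda>w. \<not> is_free w \<and> is_odd (core w))"
  define Me where "Me = mset (filter fe W)"
  define Mo where "Mo = mset (filter fo W)"
  define b where "b = 2 * (t div 2)"
  have mset_W: "mset W = mset (filter ce W) + Me + mset (filter co W) + Mo"
    unfolding Me_def Mo_def fe_def fo_def ce_def co_def mset_filter
    by (intro multiset_eqI) auto
  have Me: "count Me w = (if w \<in> Free ` frees t False then q else 0)" for w
    using count_word[OF assms(1), of q r] frees_parity
    by (cases w) (auto simp: Me_def fe_def W_def)
  have Mo: "count Mo w = (if w \<in> Free ` frees t True then q else 0)" for w
    using count_word[OF assms(1), of q r] frees_parity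
    by (cases w) (auto simp: Mo_def fo_def W_def)
  have cardF: "card (Free ` frees t False) = t" "card (Free ` frees t True) = b"
    by (simp_all add: card_image inj_on_def card_frees b_def)
  note PE = card_permutations_balanced[OF finite_imageI[OF finite_frees] Me, unfolded cardF]
  note PO = card_permutations_balanced[OF finite_imageI[OF finite_frees] Mo, unfolded cardF]
  define k where "k = length (filter ce W) + t * q"
  define l where "l = length (filter co W) + b * q"
  \<comment> \<open>Even variables come first. Constant letters keep fixed variables, and the free
    letters are permuted within each parity.\<close>
  define J where "J = (\<lambda>(e, o'). filter ce W @ e @ filter co W @ o')"
  define T where "T = J ` (permutations_of_multiset Me \<times> permutations_of_multiset Mo)"
  have len: "length e = t * q" if "e \<in> permutations_of_multiset Me" for e
    using that PE(1) by (metis permutations_of_multisetD size_mset)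
  have len': "length e = b * q" if "e \<in> permutations_of_multiset Mo" for e
    using that PO(1) by (metis permutations_of_multisetD size_mset)
  have inj: "inj_on J (permutations_of_multiset Me \<times> permutations_of_multiset Mo)"
    using len len' by (auto simp: inj_on_def J_def)
  have card_T: "card T = card (permutations_of_multiset Me) * card (permutations_of_multiset Mo)"
    unfolding T_def by (simp add: card_image inj card_cartesian_product)
  have Fe: "w \<in> Free ` frees t False" if "e \<in> permutations_of_multiset Me" "w \<in> set e" for w e
    using that Me[of w] by (metis count_eq_zero_iff permutations_of_multisetD set_mset_mset)
  have Fo: "w \<in> Free ` frees t True" if "e \<in> permutations_of_multiset Mo" "w \<in> set e" for w e
    using that Mo[of w] by (metis count_eq_zero_iff permutations_of_multisetD set_mset_mset)
  obtain u ws where uws: "W = Con u # ws"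
    "prog kd t (letter kd t u :: 'a mat_fn \<times> bool) ws (even_state kd t 0)"
    using prog_word[OF assms(1,2)] W_def by blast
  have const: "map (\<lambda>w. is_odd (core w)) xs = replicate (length xs) c" if "\<And>w. w \<in> set xs \<Longrightarrow> is_odd
      (core w) = c" for xs c
    using that by (induction xs) auto
  have "card T \<le> ccodim TYPE('a) kd t k (k + l)"
  proof (rule ccodim_ge_words[OF uws assms(1)])
    fix \<tau> assume "\<tau> \<in> T"
    then obtain e o' where \<tau>: "\<tau> = filter ce W @ e @ filter co W @ o'"
      "e \<in> permutations_of_multiset Me" "o' \<in> permutations_of_multiset Mo" by (auto simp: T_def J_def)
    show "mset \<tau> = mset W"
      by (simp only: \<tau>(1) mset_W mset_append permutations_of_multisetD[OF \<tau>(2)]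
        permutations_of_multisetD[OF \<tau>(3)] add_ac)
    have "map (\<lambda>w. is_odd (core w)) (filter ce W @ e) = replicate (length (filter ce W @ e)) False"
      by (rule const) (auto simp: ce_def dest!: Fe[OF \<tau>(2)] frees_parity)
    then have "map (\<lambda>w. is_odd (core w)) (filter ce W @ e) = replicate k False"
      by (simp only: length_append len[OF \<tau>(2)] k_def)
    moreover have "map (\<lambda>w. is_odd (core w)) (filter co W @ o') = replicate (length (filter co W @
        o')) True"
      by (rule const) (auto simp: co_def dest!: Fo[OF \<tau>(3)] frees_parity)
    then have "map (\<lambda>w. is_odd (core w)) (filter co W @ o') = replicate l True"
      by (simp only: length_append len'[OF \<tau>(3)] l_def)
    ultimately show "map (\<lambda>w. is_odd (core w)) \<tau> = replicate k False @ replicate l True"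
      unfolding \<tau> by (metis append.assoc map_append)
  next
    fix \<tau> \<tau>' assume "\<tau> \<in> T" "\<tau>' \<in> T"
    then obtain e o' e2 o2 where \<tau>: "\<tau> = filter ce W @ e @ filter co W @ o'" "\<tau>' = filter ce W @
        e2 @ filter co W @ o2"
      "e \<in> permutations_of_multiset Me" "o' \<in> permutations_of_multiset Mo"
      "e2 \<in> permutations_of_multiset Me" "o2 \<in> permutations_of_multiset Mo" by (auto simp: T_def J_def)
    have compat_self: "list_all2 (compat t) xs xs" if "\<And>w. w \<in> set xs \<Longrightarrow> \<not> is_free w" for xs
    proof (rule list_all2_all_nthI)
      fix i assume "i < length xs"
      then show "compat t (xs ! i) (xs ! i)"
        using that[OF nth_mem, of i] by (cases "xs ! i") (auto simp: compat_simps)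
    qed simp
    have "list_all2 (compat t) e e2"
    proof (rule list_all2_all_nthI)
      fix i assume "i < length e"
      then have "e ! i \<in> Free ` frees t False" "e2 ! i \<in> Free ` frees t False"
        using \<tau> Fe len by (metis nth_mem)+
      then show "compat t (e ! i) (e2 ! i)" using frees_parity by (auto simp: compat_simps)
    qed (simp add: len \<tau>)
    moreover have "list_all2 (compat t) o' o2"
    proof (rule list_all2_all_nthI)
      fix i assume "i < length o'"
      then have "o' ! i \<in> Free ` frees t True" "o2 ! i \<in> Free ` frees t True"
        using \<tau> Fo len' by (metis nth_mem)+
      then show "compat t (o' ! i) (o2 ! i)" using frees_parity by (auto simp: compat_simps)
    qed (simp add: len' \<tau>)
    moreover have "list_all2 (compat t) (filter ce W) (filter ce W)"
      "list_all2 (compat t) (filter co W) (filter co W)"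
      by (rule compat_self; simp add: ce_def co_def)+
    ultimately show "list_all2 (compat t) \<tau> \<tau>'"
      unfolding \<tau> by (intro list_all2_appendI)
  qed (use valid_word[OF assms(1)] W_def in auto)
  moreover have n: "N * q + (length (word t 0 0) + r) = k + l"
  proof -
    have "length W = length (filter ce W) + size Me + length (filter co W) + size Mo"
      using arg_cong[OF mset_W, of size] by (simp only: size_mset size_union)
    then have "length W = k + l" and "length W = N * q + (length (filter ce W) + length (filter co W))"
      by (simp_all add: k_def l_def PE(1) PO(1) N_def b_def algebra_simps)
    moreover have "length (filter ce W) = length (filter ce (word t 0 0)) + r"
      unfolding W_def by (subst length_filter_word) (auto simp: ce_def)
    moreover have "length (filter co W) = length (filter co (word t 0 0))"
      unfolding W_def by (subst length_filter_word) (auto simp: co_def)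
    moreover have "length (filter ce (word t 0 0)) + length (filter co (word t 0 0)) = length
        (word t 0 0)"
    proof -
      have "\<not> is_free w" if "w \<in> set (word t 0 0)" for w
        using that count_word[OF assms(1), of 0 0] by (metis count_eq_zero_iff set_mset_mset)
      then have "filter co (word t 0 0) = filter (\<lambda>w. \<not> ce w) (word t 0 0)"
        by (intro filter_cong) (auto simp: ce_def co_def)
      then show ?thesis by (simp add: sum_length_filter_compl)
    qed
    ultimately show ?thesis by simp
  qed
  ultimately have codim: "card T \<le> ccodim TYPE('a) kd t k (k + l)" by simp
  have "((k + l) choose k) * ccodim TYPE('a) kd t k (k + l) \<le> gr_codim TYPE('a) kd t (k + l)"
    unfolding gr_codim_def by (rule member_le_sum) auto
  moreover have "((t * q + b * q) choose (t * q)) * card T \<le> ((k + l) choose k) * ccodim TYPE('a)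
      kd t k (k + l)"
    by (intro mult_mono codim binomial_mono2) (auto simp: k_def l_def)
  ultimately have le: "((t * q + b * q) choose (t * q)) * card T \<le> gr_codim TYPE('a) kd t (k + l)"
    by linarith
  have "fact (N * q) = ((t * q + b * q) choose (t * q)) * (fact (t * q) * fact (b * q))"
    using binomial_fact_lemma[of "t * q" "t * q + b * q"]
    by (simp add: N_def b_def algebra_simps)
  also have "\<dots> = ((t * q + b * q) choose (t * q)) * card T * fact q ^ N"
    unfolding card_T PE(2)[symmetric] PO(2)[symmetric] N_def b_def[symmetric] power_add
    by (simp only: mult_ac)
  also have "\<dots> \<le> gr_codim TYPE('a) kd t (k + l) * fact q ^ N"
    by (intro mult_right_mono le) simp
  finally show ?thesis unfolding n .
qed

text \<open>With \<open>d\<close> the length of the word for \<open>q = r = 0\<close>, division of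
  \<open>n - d\<close> by \<open>N\<close> yields \<open>q\<close> and the padding \<open>r\<close>.
  The threshold \<open>d + 2 * N\<close> makes \<open>q\<close> positive, as the factorial bound
  needs, and the remaining power \<open>N ^ (d + r)\<close> is bounded by a constant.\<close>

lemma gr_codim_lower_power:
  assumes "t \<ge> 2" "inv_ok kd t"
  defines "N \<equiv> t + 2 * (t div 2)"
  obtains c where "\<And>n. n \<ge> c \<Longrightarrow> N ^ n \<le> N ^ c * n ^ N * gr_codim TYPE('a::field_char_0) kd t n"
proof -
  have N: "N \<ge> 1" using assms(1) by (simp add: N_def)
  define d where "d = length (word t 0 0)"
  have "N ^ n \<le> N ^ (d + 2 * N) * n ^ N * gr_codim TYPE('a) kd t n" if n: "n \<ge> d + 2 * N" for n
  proof -
    define q where "q = (n - d) div N"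
    define r where "r = (n - d) mod N"
    have n_eq: "n = N * q + (d + r)" using n by (simp add: q_def r_def)
    have r: "r < N" using N by (simp add: r_def)
    have "q \<noteq> 0" using n_eq n r by (intro notI) simp
    then obtain q' where q': "q = Suc q'" by (cases q) auto
    have "N ^ (N * q) * fact q ^ N \<le> fact (N * q) * (N * q) ^ N"
      using balanced_factorial_bound[OF N, of q'] q' by simp
    also have "\<dots> \<le> gr_codim TYPE('a) kd t n * fact q ^ N * (N * q) ^ N"
      using gr_codim_lower[OF assms(1,2), where ?'a = 'a, of q r] n_eq
      by (intro mult_right_mono) (simp_all add: N_def d_def)
    finally have "N ^ (N * q) * fact q ^ N \<le> (gr_codim TYPE('a) kd t n * (N * q) ^ N) * fact q ^ N"
      by (simp only: mult_ac)
    then have "N ^ (N * q) \<le> gr_codim TYPE('a) kd t n * (N * q) ^ N" by simp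
    also have "\<dots> \<le> gr_codim TYPE('a) kd t n * n ^ N"
      using n_eq by (intro mult_left_mono power_mono) auto
    finally have *: "N ^ (N * q) \<le> gr_codim TYPE('a) kd t n * n ^ N" .
    have "N ^ n = N ^ (d + r) * N ^ (N * q)"
      by (subst n_eq) (simp add: power_add mult_ac)
    also have "\<dots> \<le> N ^ (d + 2 * N) * (gr_codim TYPE('a) kd t n * n ^ N)"
      using r N * by (intro mult_mono power_increasing) auto
    finally show ?thesis by (simp only: mult_ac)
  qed
  then show ?thesis using that by blast
qed

section \<open>The limit of the roots\<close>

text \<open>The \<open>n\<close>-th roots of a positive constant and of \<open>n\<close> itself tend
  to 1, so only the exponential factor is left.\<close>

lemma root_poly_exp_tendsto:
  assumes "C > 0" "x \<ge> 0"
  shows "(\<lambda>n. root n (C * real n ^ d * x ^ n)) \<longlonglongrightarrow> x"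
proof -
  have "(\<lambda>n. root n C * root n (real n) ^ d * x) \<longlonglongrightarrow> 1 * 1 ^ d * x"
    using assms by (intro tendsto_intros LIMSEQ_root LIMSEQ_root_const)
  moreover have "\<forall>\<^sub>F n in sequentially. root n C * root n (real n) ^ d * x = root n (C * real n ^
      d * x ^ n)"
    using eventually_gt_at_top[of 0]
    by eventually_elim (use assms in \<open>simp add: real_root_mult real_root_power real_root_power_cancel\<close>)
  ultimately show ?thesis by (simp add: tendsto_cong)
qed

theorem theorem1:
  fixes t :: nat and kd :: inv_kind
  assumes "t \<ge> 2"
    and "kd = Orth \<or> (kd = Symp \<and> even t)"
  shows "(\<lambda>n. root n (real (gr_codim (TYPE('a::field_char_0)) kd t n)))
           \<longlonglongrightarrow> (if even t then real (2 * t) else real (2 * t) - 1)"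
proof -
  define N where "N = t + 2 * (t div 2)"
  have N: "N \<ge> 1" "real N = (if even t then real (2 * t) else real (2 * t) - 1)"
    using assms(1) by (auto simp: N_def elim!: evenE oddE)
  define g where "g n = real (gr_codim TYPE('a) kd t n)" for n
  have ok: "inv_ok kd t" using assms(2) by (simp add: inv_ok_def)
  obtain c where c: "\<And>n. n \<ge> c \<Longrightarrow> N ^ n \<le> N ^ c * n ^ N * gr_codim TYPE('a) kd t n"
    using gr_codim_lower_power[OF assms(1) ok] unfolding N_def by blast
  obtain C where C: "C > 0" "\<And>n. g n \<le> C * real (Suc n) ^ (2*t) * real N ^ n"
    using gr_codim_upper[OF assms(1)] unfolding N_def g_def by blast
  have low: "root n (real N ^ n) \<le> root n (real N ^ c * real n ^ N * g n)" if "n > 0" "n \<ge> c" for n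
  proof -
    have "real (N ^ n) \<le> real (N ^ c * n ^ N * gr_codim TYPE('a) kd t n)"
      using c[OF that(2)] by (simp only: of_nat_le_iff)
    then show ?thesis using that(1) by (simp add: g_def)
  qed
  \<comment> \<open>The factor \<open>1 ^ n\<close> brings the denominator into the form of
    \<open>root_poly_exp_tendsto\<close> with base 1.\<close>
  have lower: "\<forall>\<^sub>F n in sequentially. real N / root n (real N ^ c * real n ^ N * 1 ^ n) \<le> root n (g n)"
    using eventually_gt_at_top[of 0] eventually_ge_at_top[of c]
  proof eventually_elim
    case (elim n)
    have "real N = root n (real N ^ n)"
      using elim by (simp add: real_root_power_cancel)
    also have "\<dots> \<le> root n (real N ^ c * real n ^ N) * root n (g n)"
      using low[OF elim] by (simp add: real_root_mult)
    finally show ?case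
      using elim N by (simp add: divide_le_eq mult.commute)
  qed
  \<comment> \<open>For positive \<open>n\<close>, \<open>Suc n \<le> 2 * n\<close> replaces the
    shifted power at the cost of the constant \<open>2 ^ (2*t)\<close>.\<close>
  have upper: "\<forall>\<^sub>F n in sequentially. root n (g n) \<le> root n (C * 2 ^ (2*t) * real n ^ (2*t) * real
      N ^ n)"
    using eventually_gt_at_top[of 0]
  proof eventually_elim
    case (elim n)
    have "g n \<le> C * real (Suc n) ^ (2*t) * real N ^ n" by (rule C)
    also have "\<dots> \<le> C * (2 * real n) ^ (2*t) * real N ^ n"
      using elim C(1) by (intro mult_right_mono mult_left_mono power_mono) auto
    finally show ?case using elim by (simp add: power_mult_distrib mult.assoc)
  qed
  have "(\<lambda>n. root n (real N ^ c * real n ^ N * 1 ^ n)) \<longlonglongrightarrow> 1"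
    using N by (intro root_poly_exp_tendsto) auto
  then have "(\<lambda>n. real N / root n (real N ^ c * real n ^ N * 1 ^ n)) \<longlonglongrightarrow> real N / 1"
    by (intro tendsto_divide tendsto_const) auto
  moreover have "(\<lambda>n. root n (C * 2 ^ (2*t) * real n ^ (2*t) * real N ^ n)) \<longlonglongrightarrow> real N"
    using C(1) by (intro root_poly_exp_tendsto) auto
  ultimately have "(\<lambda>n. root n (g n)) \<longlonglongrightarrow> real N"
    using tendsto_sandwich[OF lower upper] by simp
  then show ?thesis unfolding g_def N(2) .
qed

end
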